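(* Let $\mathbb{X},\mathbb{Y}$ be finite dimensional real inner product spaces, $f:\mathbb{X}\to(-\infty,\infty]$ and $g:\mathbb{Y}\to(-\infty,\infty]$ be proper, lower semicontinuous and bounded below, $H:\mathbb{X}\times\mathbb{Y}\to\mathbb{R}$ be a smooth function such that $\nabla_xH(\cdot,y)$ is $L_1(y)$-Lipschitz for each $y$ and $\nabla_yH(x,\cdot)$ is $L_2(x)$-Lipschitz for each $x$, and let $\Psi(x,y):=f(x)+g(y)+H(x,y)$ be coercive and bounded below. Let $\{(x^k,y^k)\}_{k\in\mathbb{N}}$ be generated by the PALMenls algorithm (described in the context), and let $z^k:=(x^k,y^k,x^{k-1},y^{k-1})$. Then the following results hold. (i) $\liminf_{k\to\infty}\Upsilon_\delta(z^k)\ge\lim_{k\to\infty}\Upsilon_\delta(z^{\ell(k)})$. (ii) For each subsequence $\{z^{k_q}\}_{q\in\mathbb{N}}$ with $\lim_{q\to\infty}z^{k_q}=\widehat{z}=(\widehat{x},\widehat{y},\widehat{x},\widehat{y})$, one has $\limsup_{q\to\infty}\Upsilon_\delta(z^{k_q})\le\Upsilon_\delta(\widehat{z})$. (iii) For each $k\in\mathbb{N}$ there exists $w^{k+1}\in\partial\Upsilon_\delta(z^{k+1})$ with $$\|w^{k+1}\|\le\big[2\delta+2\max(1,\beta_{\max})(M+2\underline{\tau}^{-1}+\overline{L}_2)\big]\,\|z^{k+1}-z^k\|.$$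
   Context: $\partial$ is the limiting (Mordukhovich) subdifferential. For $\tau>0$, $\mathcal{P}_\tau h(x):=\arg\min_{z}\{\frac{1}{2\tau}\|z-x\|^2+h(z)\}$. For $\delta>0$ and $z=(x,y,u,v)\in\mathbb{X}\times\mathbb{Y}\times\mathbb{X}\times\mathbb{Y}$, $\Upsilon_\delta(z):=f(x)+g(y)+H(x,y)+\frac{\delta}{2}\|x-u\|^2+\frac{\delta}{2}\|y-v\|^2$. Products carry the product Euclidean norm. $[t]_+:=\max(0,t)$. PALMenls algorithm (nonmonotone line search PALM with extrapolation). Choose an integer $m\ge0$ and $(x^0,y^0)\in\mathrm{dom}\,\Psi$; let $\mathcal{L}_0:=\{(x,y)\,|\,\Psi(x,y)\le\Psi(x^0,y^0)\}$ (compact) and $L:=\max_{(x,y)\in\mathcal{L}_0}\max(L_1(y),L_2(x))$. Parameters: $\delta\in(0,1)$, $\alpha\in(0,\delta/2]$, $0<\underline{\tau}<\frac{1}{L+\delta+2\alpha}<\overline{\tau}$, $\beta_{\max}\ge0$, $\eta,\eta_1,\eta_2\in(0,1)$. Set $(x^{-1},y^{-1})=(x^0,y^0)$, $z^0=(x^0,y^0,x^{-1},y^{-1})$. Iteration $k=0,1,2,\ldots$ (run indefinitely): choose any $\beta_{k,0}\in[0,\beta_{\max}]$, $\tau_{1,k}^0,\tau_{2,k}^0\in[\underline{\tau},\overline{\tau}]$; for $l=0,1,2,\ldots$ set $\beta_k=\beta_{k,0}\eta^l$, $\tau_{1,k}=\max\{\tau_{1,k}^0\eta_1^l,\underline{\tau}\}$,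 $\tau_{2,k}=\max\{\tau_{2,k}^0\eta_2^l,\underline{\tau}\}$, $\widetilde{x}^k=x^k+\beta_k(x^k-x^{k-1})$, pick $x^{k+1}\in\mathcal{P}_{\tau_{1,k}}f(\widetilde{x}^k-\tau_{1,k}\nabla_xH(\widetilde{x}^k,y^k))$, $\widetilde{y}^k=y^k+\beta_k(y^k-y^{k-1})$, pick $y^{k+1}\in\mathcal{P}_{\tau_{2,k}}g(\widetilde{y}^k-\tau_{2,k}\nabla_yH(x^{k+1},\widetilde{y}^k))$, $z^{k+1}=(x^{k+1},y^{k+1},x^k,y^k)$, and stop the inner loop (accepting the point) as soon as $\Upsilon_\delta(z^{k+1})\le\max_{j=[k-m]_+,\ldots,k}\Upsilon_\delta(z^j)-\frac{\alpha}{2}\|z^{k+1}-z^k\|^2$. The sequence $\{z^k\}$ is bounded. $B_1$ and $B_2$ are balls centered at the origin containing $\{(1+2\beta_{\max})x^k\}_{k}$ and $\{(1+2\beta_{\max})y^k\}_{k}$ respectively; $M:=\sup_{x\ne x'\in B_1,\,y\ne y'\in B_2}\frac{\|\nabla_xH(x,y)-\nabla_xH(x',y')\|}{\|(x,y)-(x',y')\|}$ and $\overline{L}_2:=\sup_{x\in B_1}L_2(x)$; the quantities $L$, $M$, $\overline{L}_2$ are taken to be finite. $\ell(k)$ denotes the largest index in $\arg\max_{j=[k-m]_+,\ldots,k}\Upsilon_\delta(z^j)$; the sequence $\{\Upsilon_\delta(z^{\ell(k)})\}_k$ is nonincreasing and bounded below, so its limit exists. *)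

theory Defs
  imports "HOL-Analysis.Analysis"
begin

definition gradient :: "('a::real_inner \<Rightarrow> real) \<Rightarrow> 'a \<Rightarrow> 'a" where
  "gradient F x = (THE D. GDERIV F x :> D)"

definition C1_smooth :: "('a::real_inner \<Rightarrow> real) \<Rightarrow> bool" where
  "C1_smooth F \<longleftrightarrow> (\<forall>x. F differentiable (at x)) \<and> continuous_on UNIV (gradient F)"

definition grad_x :: "('a::real_inner \<times> 'b::real_inner \<Rightarrow> real) \<Rightarrow> 'a \<Rightarrow> 'b \<Rightarrow> 'a" where
  "grad_x H x y = gradient (\<lambda>x'. H (x', y)) x"

definition grad_y :: "('a::real_inner \<times> 'b::real_inner \<Rightarrow> real) \<Rightarrow> 'a \<Rightarrow> 'b \<Rightarrow> 'b" where
  "grad_y H x y = gradient (\<lambda>y'. H (x, y')) y"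

(* A function with values in (-\<infinity>, \<infinity>] is an ereal-valued function that avoids -\<infinity>. *)
definition proper :: "('a \<Rightarrow> ereal) \<Rightarrow> bool" where
  "proper h \<longleftrightarrow> (\<forall>x. h x \<noteq> -\<infinity>) \<and> (\<exists>x. h x \<noteq> \<infinity>)"

definition lower_semicont :: "('a::topological_space \<Rightarrow> ereal) \<Rightarrow> bool" where
  "lower_semicont h \<longleftrightarrow> (\<forall>x. h x \<le> Liminf (at x) h)"

definition bounded_below :: "('a \<Rightarrow> ereal) \<Rightarrow> bool" where
  "bounded_below h \<longleftrightarrow> (\<exists>c::real. \<forall>x. ereal c \<le> h x)"

definition coercive :: "('a::real_normed_vector \<Rightarrow> ereal) \<Rightarrow> bool" where
  "coercive h \<longleftrightarrow> (h \<longlongrightarrow> \<infinity>) at_infinity"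

(* Regular (Frechet) subdifferential; empty at points where h is not finite. *)
definition frechet_subdiff :: "('a::real_inner \<Rightarrow> ereal) \<Rightarrow> 'a \<Rightarrow> 'a set" where
  "frechet_subdiff h x = {v. \<bar>h x\<bar> \<noteq> \<infinity> \<and>
     0 \<le> Liminf (at x) (\<lambda>x'. (h x' - h x - ereal (inner v (x' - x))) / ereal (norm (x' - x)))}"

definition limiting_subdiff :: "('a::real_inner \<Rightarrow> ereal) \<Rightarrow> 'a \<Rightarrow> 'a set" where
  "limiting_subdiff h x = {v. \<bar>h x\<bar> \<noteq> \<infinity> \<and>
     (\<exists>xs vs. (\<forall>n. vs n \<in> frechet_subdiff h (xs n)) \<and>
        xs \<longlonglongrightarrow> x \<and> (\<lambda>n. h (xs n)) \<longlonglongrightarrow> h x \<and> vs \<longlonglongrightarrow> v)}"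

definition prox :: "real \<Rightarrow> ('a::real_inner \<Rightarrow> ereal) \<Rightarrow> 'a \<Rightarrow> 'a set" where
  "prox \<tau> h x =
     {z. is_arg_min (\<lambda>z. ereal (1 / (2 * \<tau>) * (norm (z - x))\<^sup>2) + h z) (\<lambda>_. True) z}"

definition Psi ::
  "('a::euclidean_space \<Rightarrow> ereal) \<Rightarrow> ('b::euclidean_space \<Rightarrow> ereal) \<Rightarrow> ('a \<times> 'b \<Rightarrow> real)
    \<Rightarrow> 'a \<times> 'b \<Rightarrow> ereal" where
  "Psi f g H = (\<lambda>(x, y). f x + g y + ereal (H (x, y)))"

definition Upsilon ::
  "real \<Rightarrow> ('a::euclidean_space \<Rightarrow> ereal) \<Rightarrow> ('b::euclidean_space \<Rightarrow> ereal) \<Rightarrow> ('a \<times> 'b \<Rightarrow> real)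
    \<Rightarrow> 'a \<times> 'b \<times> 'a \<times> 'b \<Rightarrow> ereal" where
  "Upsilon \<delta> f g H = (\<lambda>(x, y, u, v). f x + g y + ereal (H (x, y))
     + ereal (\<delta> / 2 * (norm (x - u))\<^sup>2) + ereal (\<delta> / 2 * (norm (y - v))\<^sup>2))"

(* Truncated subtraction gives x (0 - 1) = x 0, which is the convention x^{-1} = x^0
   (likewise for y), and k - m = [k - m]_+ for the window of the line search. *)
definition zseq :: "(nat \<Rightarrow> 'a) \<Rightarrow> (nat \<Rightarrow> 'b) \<Rightarrow> nat \<Rightarrow> 'a \<times> 'b \<times> 'a \<times> 'b" where
  "zseq x y k = (x k, y k, x (k - 1), y (k - 1))"

definition window_max :: "nat \<Rightarrow> (nat \<Rightarrow> ereal) \<Rightarrow> nat \<Rightarrow> ereal" where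
  "window_max m U k = Max (U ` {k - m..k})"

definition window_argmax :: "nat \<Rightarrow> (nat \<Rightarrow> ereal) \<Rightarrow> nat \<Rightarrow> nat" where
  "window_argmax m U k = Max {j. is_arg_max U (\<lambda>j. j \<in> {k - m..k}) j}"

(* (xn, yn) is a possible pair computed at iteration k with the step parameters beta, tau1, tau2. *)
definition palm_trial ::
  "('a::euclidean_space \<Rightarrow> ereal) \<Rightarrow> ('b::euclidean_space \<Rightarrow> ereal) \<Rightarrow> ('a \<times> 'b \<Rightarrow> real)
    \<Rightarrow> (nat \<Rightarrow> 'a) \<Rightarrow> (nat \<Rightarrow> 'b) \<Rightarrow> nat \<Rightarrow> real \<Rightarrow> real \<Rightarrow> real \<Rightarrow> 'a \<Rightarrow> 'b \<Rightarrow> bool" where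
  "palm_trial f g H x y k \<beta> \<tau>1 \<tau>2 xn yn \<longleftrightarrow>
     (let xt = x k + \<beta> *\<^sub>R (x k - x (k - 1));
          yt = y k + \<beta> *\<^sub>R (y k - y (k - 1))
      in xn \<in> prox \<tau>1 f (xt - \<tau>1 *\<^sub>R grad_x H xt (y k)) \<and>
         yn \<in> prox \<tau>2 g (yt - \<tau>2 *\<^sub>R grad_y H xn yt))"

definition ls_accept ::
  "('a::euclidean_space \<Rightarrow> ereal) \<Rightarrow> ('b::euclidean_space \<Rightarrow> ereal) \<Rightarrow> ('a \<times> 'b \<Rightarrow> real)
    \<Rightarrow> real \<Rightarrow> real \<Rightarrow> nat \<Rightarrow> (nat \<Rightarrow> 'a) \<Rightarrow> (nat \<Rightarrow> 'b) \<Rightarrow> nat \<Rightarrow> 'a \<Rightarrow> 'b \<Rightarrow> bool" where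
  "ls_accept f g H \<delta> \<alpha> m x y k xn yn \<longleftrightarrow>
     (let zn = (xn, yn, x k, y k)
      in Upsilon \<delta> f g H zn
           \<le> window_max m (\<lambda>j. Upsilon \<delta> f g H (zseq x y j)) k
             - ereal (\<alpha> / 2 * (norm (zn - zseq x y k))\<^sup>2))"

(* The inner loop of iteration k produces trial points (X i, Y i), i = 0, ..., l: the first l
   of them are rejected by the line search and the last one is accepted. *)
definition palmenls_step ::
  "('a::euclidean_space \<Rightarrow> ereal) \<Rightarrow> ('b::euclidean_space \<Rightarrow> ereal) \<Rightarrow> ('a \<times> 'b \<Rightarrow> real)
    \<Rightarrow> real \<Rightarrow> real \<Rightarrow> real \<Rightarrow> real \<Rightarrow> real \<Rightarrow> real \<Rightarrow> real \<Rightarrow> real \<Rightarrow> nat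
    \<Rightarrow> (nat \<Rightarrow> 'a) \<Rightarrow> (nat \<Rightarrow> 'b) \<Rightarrow> nat \<Rightarrow> bool" where
  "palmenls_step f g H \<delta> \<alpha> \<tau>lo \<tau>up \<beta>max \<eta> \<eta>1 \<eta>2 m x y k \<longleftrightarrow>
     (\<exists>\<beta>0 \<in> {0..\<beta>max}. \<exists>\<tau>10 \<in> {\<tau>lo..\<tau>up}. \<exists>\<tau>20 \<in> {\<tau>lo..\<tau>up}. \<exists>l X Y.
        (\<forall>i\<le>l. palm_trial f g H x y k (\<beta>0 * \<eta> ^ i)
                 (max (\<tau>10 * \<eta>1 ^ i) \<tau>lo) (max (\<tau>20 * \<eta>2 ^ i) \<tau>lo) (X i) (Y i)) \<and>
        (\<forall>i<l. \<not> ls_accept f g H \<delta> \<alpha> m x y k (X i) (Y i)) \<and>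
        ls_accept f g H \<delta> \<alpha> m x y k (X l) (Y l) \<and>
        x (Suc k) = X l \<and> y (Suc k) = Y l)"

definition palmenls ::
  "('a::euclidean_space \<Rightarrow> ereal) \<Rightarrow> ('b::euclidean_space \<Rightarrow> ereal) \<Rightarrow> ('a \<times> 'b \<Rightarrow> real)
    \<Rightarrow> real \<Rightarrow> real \<Rightarrow> real \<Rightarrow> real \<Rightarrow> real \<Rightarrow> real \<Rightarrow> real \<Rightarrow> real \<Rightarrow> nat
    \<Rightarrow> (nat \<Rightarrow> 'a) \<Rightarrow> (nat \<Rightarrow> 'b) \<Rightarrow> bool" where
  "palmenls f g H \<delta> \<alpha> \<tau>lo \<tau>up \<beta>max \<eta> \<eta>1 \<eta>2 m x y \<longleftrightarrow>
     Psi f g H (x 0, y 0) < \<infinity> \<and>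
     (\<forall>k. palmenls_step f g H \<delta> \<alpha> \<tau>lo \<tau>up \<beta>max \<eta> \<eta>1 \<eta>2 m x y k)"

(* The difference quotients of grad_x H whose supremum is the constant M. *)
definition gradx_quotients ::
  "('a::euclidean_space \<times> 'b::euclidean_space \<Rightarrow> real) \<Rightarrow> 'a set \<Rightarrow> 'b set \<Rightarrow> real set" where
  "gradx_quotients H B1 B2 =
     {norm (grad_x H x y - grad_x H x' y') / norm ((x, y) - (x', y')) | x x' y y'.
        x \<in> B1 \<and> x' \<in> B1 \<and> x \<noteq> x' \<and> y \<in> B2 \<and> y' \<in> B2 \<and> y \<noteq> y'}"

end

theory Submission
  imports Defs
begin

text \<open>The proximal inclusions give quadratic minorants of \<open>f\<close> and \<open>g\<close> that touch at the new iterate;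
  added to the first-order expansion of the smooth part of \<open>Upsilon\<close> they exhibit a Frechet subgradient
  at \<open>z\<^sup>k\<^sup>+\<^sup>1\<close>, whose norm is bounded with the Lipschitz estimates for the gradients of \<open>H\<close>. Comparing the
  proximal objective at the new iterate and at the limit point gives (ii), because the centres stay
  bounded. For (i), if the values dropped to \<open>\<omega> - \<epsilon>\<close> infinitely often, where \<open>\<omega>\<close> is the limit of the
  window maxima, then by lower semicontinuity and (ii) they would stay a fixed distance below \<open>\<omega>\<close>
  throughout some window, contradicting that the window maxima are at least \<open>\<omega>\<close>.\<close>

subsection \<open>Gradients\<close>

lemma gradient_eqI:
  fixes F :: "'a::real_inner \<Rightarrow> real"
  assumes "(F has_derivative (\<lambda>h. inner h D)) (at x)"
  shows "gradient F x = D"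
  unfolding gradient_def
proof (rule the_equality)
  show "GDERIV F x :> D" using assms unfolding gderiv_def .
  fix E assume "GDERIV F x :> E"
  with assms have "(\<lambda>h. inner h E) = (\<lambda>h. inner h D)"
    unfolding gderiv_def by (intro has_derivative_unique)
  then have "inner (E - D) E = inner (E - D) D" by (rule fun_cong)
  then have "inner (E - D) (E - D) = 0" by (simp add: inner_diff_right)
  then show "E = D" by simp
qed

text \<open>Riesz representation in coordinates: \<open>D\<close> collects the values of the
  derivative on \<open>Basis\<close>, and uniqueness identifies it with
  \<open>gradient F x\<close>.\<close>

lemma C1_smooth_has_derivative:
  fixes F :: "'a::euclidean_space \<Rightarrow> real"
  assumes "C1_smooth F"
  shows "(F has_derivative (\<lambda>h. inner h (gradient F x))) (at x)"
proof -
  obtain F' where F': "(F has_derivative F') (at x)"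
    using assms unfolding C1_smooth_def differentiable_def by blast
  then have lin: "linear F'" by (rule has_derivative_linear)
  define D where "D = (\<Sum>b\<in>Basis. F' b *\<^sub>R b)"
  have "F' h = inner h D" for h
  proof -
    have "F' h = F' (\<Sum>b\<in>Basis. inner h b *\<^sub>R b)"
      by (simp add: euclidean_representation)
    also have "\<dots> = (\<Sum>b\<in>Basis. inner h b * F' b)"
      using lin by (simp add: linear_sum linear_cmul)
    also have "\<dots> = inner h D"
      by (simp add: D_def inner_sum_right mult.commute)
    finally show ?thesis .
  qed
  then have "F' = (\<lambda>h. inner h D)" by (rule ext)
  with F' have D: "(F has_derivative (\<lambda>h. inner h D)) (at x)" by simp
  then show ?thesis by (simp add: gradient_eqI[OF D])
qed

text \<open>Chain rule along the slice with \<open>y\<close> fixed. As a component of the full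
  gradient, the partial gradient inherits the joint continuity contained in
  \<open>C1_smooth\<close>.\<close>

lemma grad_x_eq_fst_gradient:
  fixes H :: "'a::euclidean_space \<times> 'b::euclidean_space \<Rightarrow> real"
  assumes "C1_smooth H"
  shows "grad_x H x y = fst (gradient H (x, y))"
  unfolding grad_x_def
proof (rule gradient_eqI)
  have "((\<lambda>x'. (x', y)) has_derivative (\<lambda>h. (h, 0))) (at x)"
    by (auto intro!: derivative_eq_intros)
  from has_derivative_compose[OF this C1_smooth_has_derivative[OF assms]]
  show "((\<lambda>x'. H (x', y)) has_derivative (\<lambda>h. inner h (fst (gradient H (x, y))))) (at x)"
    by (simp add: inner_prod_def)
qed

lemma grad_y_eq_snd_gradient:
  fixes H :: "'a::euclidean_space \<times> 'b::euclidean_space \<Rightarrow> real"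
  assumes "C1_smooth H"
  shows "grad_y H x y = snd (gradient H (x, y))"
  unfolding grad_y_def
proof (rule gradient_eqI)
  have "((\<lambda>y'. (x, y')) has_derivative (\<lambda>h. (0, h))) (at y)"
    by (auto intro!: derivative_eq_intros)
  from has_derivative_compose[OF this C1_smooth_has_derivative[OF assms]]
  show "((\<lambda>y'. H (x, y')) has_derivative (\<lambda>h. inner h (snd (gradient H (x, y))))) (at y)"
    by (simp add: inner_prod_def)
qed

lemma C1_smooth_continuous_gradient:
  fixes F :: "'a::euclidean_space \<Rightarrow> real"
  assumes "C1_smooth F"
  shows "continuous_on A (gradient F)"
  using assms continuous_on_subset unfolding C1_smooth_def by blast

lemma C1_smooth_bounded_gradient:
  fixes F :: "'a::euclidean_space \<Rightarrow> real"
  assumes "C1_smooth F" "bounded S"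
  obtains b where "\<And>p. p \<in> S \<Longrightarrow> norm (gradient F p) \<le> b"
proof -
  have "compact (gradient F ` closure S)"
    using assms C1_smooth_continuous_gradient[OF assms(1)]
    by (intro compact_continuous_image) auto
  then have "bounded (gradient F ` closure S)" by (rule compact_imp_bounded)
  then obtain b where "\<forall>v\<in>gradient F ` closure S. norm v \<le> b"
    unfolding bounded_iff by blast
  then show thesis using that[of b] closure_subset[of S] by blast
qed

subsection \<open>Lower semicontinuity and subdifferentials\<close>

lemma lower_semicont_liminf:
  assumes "lower_semicont h" "xs \<longlonglongrightarrow> x"
  shows "h x \<le> liminf (\<lambda>n. h (xs n))"
  unfolding le_Liminf_iff
proof (intro allI impI)
  fix c assume c: "c < h x"
  then have "\<forall>\<^sub>F x' in at x. c < h x'"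
    using assms(1) unfolding lower_semicont_def le_Liminf_iff by blast
  \<comment> \<open>\<open>lower_semicont\<close> speaks of the punctured filter
    \<open>at x\<close>, but the sequence may hit \<open>x\<close> itself; fact \<open>c\<close>
    covers that point.\<close>
  with c have "\<forall>\<^sub>F x' in nhds x. c < h x'"
    unfolding eventually_at_filter by (auto elim: eventually_mono)
  then show "\<forall>\<^sub>F n in sequentially. c < h (xs n)"
    using assms(2) by (rule eventually_compose_filterlim)
qed

text \<open>Multiplying by \<open>norm (x' - x)\<close> trades the extended-real difference quotient
  for a lower estimate of \<open>h\<close> by real numbers.\<close>

lemma frechet_subdiffI:
  fixes h :: "'a::real_inner \<Rightarrow> ereal"
  assumes "h x = ereal c"
    and "\<And>e. e > 0 \<Longrightarrow> \<forall>\<^sub>F x' in at x. ereal (c + inner v (x' - x) - e * norm (x' - x)) \<le> h x'"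
  shows "v \<in> frechet_subdiff h x"
proof -
  have "0 \<le> Liminf (at x) (\<lambda>x'. (h x' - h x - ereal (inner v (x' - x))) / ereal (norm (x' - x)))"
    unfolding le_Liminf_iff
  proof (intro allI impI)
    fix y :: ereal assume "y < 0"
    \<comment> \<open>The value 1 serves \<open>y = -\<infinity>\<close>; for real \<open>y\<close>,
      half its distance to 0 keeps the inequality strict.\<close>
    then obtain e where e: "e > 0" "y < ereal (- e)"
      using that[of 1] that[of "- real_of_ereal y / 2"] by (cases y) auto
    have "\<forall>\<^sub>F x' in at x. x' \<noteq> x" by (simp add: eventually_at_filter)
    then show "\<forall>\<^sub>F x' in at x.
        y < (h x' - h x - ereal (inner v (x' - x))) / ereal (norm (x' - x))"
      using assms(2)[OF e(1)]
    proof eventually_elim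
      case (elim x')
      then have n: "norm (x' - x) > 0" by simp
      have "ereal (- e) \<le> (h x' - h x - ereal (inner v (x' - x))) / ereal (norm (x' - x))"
      proof (cases "h x'")
        case (real r)
        with elim n assms(1) show ?thesis by (simp add: field_simps)
      qed (use elim n assms(1) in auto)
      with e(2) show ?case by order
    qed
  qed
  then show ?thesis using assms(1) unfolding frechet_subdiff_def by simp
qed

text \<open>Constant sequences are witnesses. It therefore suffices to construct a Frechet
  subgradient at each new iterate.\<close>

lemma frechet_subdiff_subset_limiting_subdiff:
  "frechet_subdiff h x \<subseteq> limiting_subdiff h x"
proof
  fix v assume v: "v \<in> frechet_subdiff h x"
  then have "\<bar>h x\<bar> \<noteq> \<infinity>" by (simp add: frechet_subdiff_def)
  then show "v \<in> limiting_subdiff h x" unfolding limiting_subdiff_def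
    using v by (simp, intro exI[of _ "\<lambda>_. x"] exI[of _ "\<lambda>_. v"]) simp
qed

subsection \<open>The proximal map\<close>

lemma prox_finite:
  assumes "proper h" "p \<in> prox \<tau> h c"
  shows "\<bar>h p\<bar> \<noteq> \<infinity>"
proof -
  obtain w where "h w \<noteq> \<infinity>" "h p \<noteq> - \<infinity>" using assms(1) unfolding proper_def by blast
  moreover have "ereal (1 / (2 * \<tau>) * (norm (p - c))\<^sup>2) + h p \<le> ereal (1 / (2 * \<tau>) * (norm (w - c))\<^sup>2) + h w"
    using assms(2) unfolding prox_def is_arg_min_def by (auto simp: not_less)
  ultimately show ?thesis by (cases "h p"; cases "h w") auto
qed

text \<open>Minimality of \<open>p\<close> tested against \<open>w\<close>, with the square centred
  at \<open>c\<close> expanded around \<open>p\<close>. With \<open>w\<close> a limit point this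
  bounds \<open>h p\<close> from above; with \<open>w\<close> free it gives a minorant of
  \<open>h\<close>.\<close>

lemma prox_lower_model:
  assumes "proper h" "p \<in> prox \<tau> h c" "\<tau> > 0"
  shows "h p \<le> h w + ereal (inner (c - p) (p - w) / \<tau> + (norm (w - p))\<^sup>2 / (2 * \<tau>))"
proof -
  have le: "ereal (1 / (2 * \<tau>) * (norm (p - c))\<^sup>2) + h p \<le> ereal (1 / (2 * \<tau>) * (norm (w - c))\<^sup>2) + h w"
    using assms(2) unfolding prox_def is_arg_min_def by (auto simp: not_less)
  have fin: "\<bar>h p\<bar> \<noteq> \<infinity>" "h w \<noteq> - \<infinity>"
    using prox_finite[OF assms(1,2)] assms(1) unfolding proper_def by auto
  have "(norm (w - c))\<^sup>2 = (norm (p - c))\<^sup>2 + 2 * inner (c - p) (p - w) + (norm (w - p))\<^sup>2"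
    by (simp add: power2_norm_eq_inner algebra_simps inner_commute)
  then have "1 / (2 * \<tau>) * (norm (w - c))\<^sup>2 = 1 / (2 * \<tau>) * (norm (p - c))\<^sup>2
      + (inner (c - p) (p - w) / \<tau> + (norm (w - p))\<^sup>2 / (2 * \<tau>))"
    using assms(3) by (simp add: field_simps)
  with le fin show ?thesis
    by (cases "h p"; cases "h w") auto
qed

text \<open>The minorant agrees with \<open>h\<close> at \<open>p\<close> and has slope
  \<open>(c - p) /\<^sub>R \<tau>\<close> there. Its quadratic defect is negligible to first order,
  so the slope is usable as a Frechet subgradient.\<close>

lemma prox_lower_bound:
  assumes "proper h" "p \<in> prox \<tau> h c" "\<tau> > 0" "h p = ereal r"
  shows "ereal (r + inner ((c - p) /\<^sub>R \<tau>) (w - p) - (norm (w - p))\<^sup>2 / (2 * \<tau>)) \<le> h w"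
proof -
  have "inner ((c - p) /\<^sub>R \<tau>) (w - p) = - (inner (c - p) (p - w) / \<tau>)"
    by (simp add: inner_diff_right divide_inverse algebra_simps)
  then show ?thesis
    using prox_lower_model[OF assms(1-3), of w] assms(4) by (cases "h w") auto
qed

text \<open>Minimality is tested at the limit \<open>ph\<close>; the linear term vanishes because a
  bounded slope meets \<open>p q - ph\<close>, which tends to 0. An explicit null sequence
  \<open>e\<close> is returned so that the estimates for \<open>f\<close> and \<open>g\<close> can
  be added termwise.\<close>

lemma prox_values_upper:
  fixes p :: "nat \<Rightarrow> 'a::real_inner"
  assumes "proper h" "0 < \<tau>lo" "p \<longlonglongrightarrow> ph"
    and "\<And>q. p q \<in> prox (\<tau> q) h (c q)" "\<And>q. \<tau>lo \<le> \<tau> q"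
    and "\<And>q. norm (c q /\<^sub>R \<tau> q) \<le> b"
  shows "\<exists>e. e \<longlonglongrightarrow> 0 \<and> (\<forall>q. h (p q) \<le> h ph + ereal (e q))"
proof -
  define s where "s q = norm (p q - ph)" for q
  have s: "s \<longlonglongrightarrow> 0"
    unfolding s_def using assms(3) by (simp add: LIM_zero tendsto_norm_zero)
  obtain B where B: "\<And>q. norm (p q) \<le> B"
    using convergent_imp_Bseq[of p] assms(3) unfolding convergent_def Bseq_def by blast
  \<comment> \<open>The first factor bounds the scaled centre plus the scaled iterate
    (Cauchy-Schwarz); the second term is the quadratic part at the smallest step size.\<close>
  define e where "e q = (b + B / \<tau>lo) * s q + (s q)\<^sup>2 / (2 * \<tau>lo)" for q
  have "e \<longlonglongrightarrow> (b + B / \<tau>lo) * 0 + 0\<^sup>2 / (2 * \<tau>lo)"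
    unfolding e_def using s assms(2) by (intro tendsto_intros) auto
  moreover have "h (p q) \<le> h ph + ereal (e q)" for q
  proof -
    have \<tau>: "\<tau> q > 0" "inverse (\<tau> q) \<le> inverse \<tau>lo"
      using assms(2) assms(5)[of q] by (auto intro: le_imp_inverse_le)
    have "inner (c q - p q) (p q - ph) / \<tau> q
        = inner (c q /\<^sub>R \<tau> q - p q /\<^sub>R \<tau> q) (p q - ph)"
      using \<tau> by (simp add: inner_diff_left field_simps)
    also have "\<dots> \<le> norm (c q /\<^sub>R \<tau> q - p q /\<^sub>R \<tau> q) * s q"
      unfolding s_def by (rule norm_cauchy_schwarz)
    also have "\<dots> \<le> (b + B / \<tau>lo) * s q"
    proof (rule mult_right_mono)
      have "norm (p q /\<^sub>R \<tau> q) \<le> inverse \<tau>lo * B"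
        using \<tau> B[of q] mult_mono[of "inverse (\<tau> q)" "inverse \<tau>lo" "norm (p q)" B] assms(2) by simp
      then show "norm (c q /\<^sub>R \<tau> q - p q /\<^sub>R \<tau> q) \<le> b + B / \<tau>lo"
        using norm_triangle_ineq4[of "c q /\<^sub>R \<tau> q" "p q /\<^sub>R \<tau> q"] assms(6)[of q]
        by (simp add: field_simps)
    qed (simp add: s_def)
    finally have "inner (c q - p q) (p q - ph) / \<tau> q \<le> (b + B / \<tau>lo) * s q" .
    moreover have "(norm (ph - p q))\<^sup>2 / (2 * \<tau> q) \<le> (s q)\<^sup>2 / (2 * \<tau>lo)"
      unfolding s_def using assms(2) assms(5)[of q]
      by (auto simp: norm_minus_commute intro!: divide_left_mono)
    ultimately have "inner (c q - p q) (p q - ph) / \<tau> q + (norm (ph - p q))\<^sup>2 / (2 * \<tau> q) \<le> e q"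
      unfolding e_def by simp
    then have "h ph + ereal (inner (c q - p q) (p q - ph) / \<tau> q + (norm (ph - p q))\<^sup>2 / (2 * \<tau> q))
        \<le> h ph + ereal (e q)"
      by (intro add_left_mono) simp
    with prox_lower_model[OF assms(1) assms(4) \<tau>(1), of ph] show ?thesis
      by order
  qed
  ultimately show ?thesis by (intro exI[of _ e]) simp
qed

subsection \<open>Nonmonotone descent\<close>

text \<open>A value well below the limit of the window maxima forces the next value below it too: otherwise
  the descent inequality makes consecutive iterates merge along a subsequence, where \<open>lim\<close> compares
  the two values. Iterating over a whole window then pushes its maximum below the limit.\<close>

lemma nonmonotone_descent_step:
  fixes Z :: "nat \<Rightarrow> 'c::{heine_borel,real_normed_vector}" and u W :: "nat \<Rightarrow> real"
  assumes "bounded (range Z)" "0 < a" "W \<longlonglongrightarrow> \<omega>"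
    and desc: "\<And>k. u (Suc k) \<le> W k - a * (norm (Z (Suc k) - Z k))\<^sup>2"
    and lim: "\<And>r p. (\<lambda>q. Z (r q)) \<longlonglongrightarrow> p \<Longrightarrow> (\<lambda>q. Z (Suc (r q))) \<longlonglongrightarrow> p \<Longrightarrow>
      limsup (\<lambda>q. ereal (u (Suc (r q)))) \<le> liminf (\<lambda>q. ereal (u (r q)))"
    and "0 < \<epsilon>"
  shows "\<exists>\<epsilon>'>0. \<exists>K. \<forall>k\<ge>K. u k \<le> \<omega> - \<epsilon> \<longrightarrow> u (Suc k) \<le> \<omega> - \<epsilon>'"
proof (rule ccontr)
  assume no: "\<not> ?thesis"
  \<comment> \<open>The negated claim is used with margin \<open>inverse (real (Suc n))\<close> and
    threshold \<open>n\<close>, so that the indices tend to infinity while the margins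
    vanish.\<close>
  have "\<exists>k\<ge>n. u k \<le> \<omega> - \<epsilon> \<and> \<omega> - inverse (real (Suc n)) < u (Suc k)" for n
    using no by (metis inverse_positive_iff_positive not_less of_nat_0_less_iff zero_less_Suc)
  then obtain k where k: "\<And>n. k n \<ge> n" "\<And>n. u (k n) \<le> \<omega> - \<epsilon>"
      "\<And>n. \<omega> - inverse (real (Suc n)) < u (Suc (k n))"
    by metis
  have k_lim: "filterlim k at_top sequentially"
    using k(1) by (auto simp: filterlim_at_top eventually_sequentially intro: order_trans)
  have "compact (closure (range Z))" using assms(1) by simp
  moreover have "\<forall>n. Z (k n) \<in> closure (range Z)"
    using closure_subset by fastforce
  ultimately obtain p s where s: "strict_mono s" "((\<lambda>n. Z (k n)) \<circ> s) \<longlonglongrightarrow> p"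
    unfolding compact_def by metis
  have low: "(\<lambda>n. \<omega> - inverse (real (Suc n))) \<longlonglongrightarrow> \<omega>"
    using tendsto_diff[OF tendsto_const LIMSEQ_inverse_real_of_nat, of \<omega>] by simp
  \<comment> \<open>By the descent inequality this gap dominates \<open>a\<close> times the squared
    step length, so the steps along \<open>k\<close> tend to 0.\<close>
  have "(\<lambda>n. W (k n) - (\<omega> - inverse (real (Suc n)))) \<longlonglongrightarrow> \<omega> - \<omega>"
    using filterlim_compose[OF assms(3) k_lim] low by (rule tendsto_diff)
  then have "(\<lambda>n. (W (k n) - (\<omega> - inverse (real (Suc n)))) / a) \<longlonglongrightarrow> 0"
    using tendsto_divide[of _ _ _ "\<lambda>_. a" a] assms(2) by fastforce
  then have "(\<lambda>n. (norm (Z (Suc (k n)) - Z (k n)))\<^sup>2) \<longlonglongrightarrow> 0"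
  proof (rule tendsto_0_le[where K = 1])
    show "\<forall>\<^sub>F n in sequentially. norm ((norm (Z (Suc (k n)) - Z (k n)))\<^sup>2)
        \<le> norm ((W (k n) - (\<omega> - inverse (real (Suc n)))) / a) * 1"
    proof (intro always_eventually allI)
      fix n
      have "a * (norm (Z (Suc (k n)) - Z (k n)))\<^sup>2 \<le> W (k n) - (\<omega> - inverse (real (Suc n)))"
        using desc[of "k n"] k(3)[of n] by linarith
      then have "(norm (Z (Suc (k n)) - Z (k n)))\<^sup>2 \<le> (W (k n) - (\<omega> - inverse (real (Suc n)))) / a"
        using assms(2) by (simp add: pos_le_divide_eq mult.commute)
      then show "norm ((norm (Z (Suc (k n)) - Z (k n)))\<^sup>2)
        \<le> norm ((W (k n) - (\<omega> - inverse (real (Suc n)))) / a) * 1"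
        by (simp only: real_norm_def mult_1_right) (smt (verit) zero_le_power2)
    qed
  qed
  from tendsto_real_sqrt[OF this] have "(\<lambda>n. Z (Suc (k n)) - Z (k n)) \<longlonglongrightarrow> 0"
    by (simp add: tendsto_norm_zero_iff)
  then have "(\<lambda>q. Z (Suc (k (s q))) - Z (k (s q))) \<longlonglongrightarrow> 0"
    using LIMSEQ_subseq_LIMSEQ[OF _ s(1)] by (fastforce simp: o_def)
  from tendsto_add[OF s(2) this] have "(\<lambda>q. Z (Suc (k (s q)))) \<longlonglongrightarrow> p"
    by (simp add: o_def)
  with s(2) have "limsup (\<lambda>q. ereal (u (Suc (k (s q))))) \<le> liminf (\<lambda>q. ereal (u (k (s q))))"
    by (intro lim) (simp_all add: o_def)
  also have "\<dots> \<le> ereal (\<omega> - \<epsilon>)"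
    using k(2) by (intro order_trans[OF Liminf_le_Limsup Limsup_bounded] always_eventually) auto
  finally have "limsup (\<lambda>q. ereal (u (Suc (k (s q))))) \<le> ereal (\<omega> - \<epsilon>)" .
  \<comment> \<open>The successors were chosen above \<omega> up to a vanishing margin, so their
    limsup cannot be \<omega> - \<epsilon> or less.\<close>
  moreover have "ereal \<omega> \<le> limsup (\<lambda>q. ereal (u (Suc (k (s q)))))"
  proof -
    have "(\<lambda>q. ereal (\<omega> - inverse (real (Suc (s q))))) \<longlonglongrightarrow> ereal \<omega>"
      using LIMSEQ_subseq_LIMSEQ[OF low s(1)] by (simp add: o_def)
    then have "ereal \<omega> = limsup (\<lambda>q. ereal (\<omega> - inverse (real (Suc (s q)))))"
      by (intro lim_imp_Limsup[symmetric]) simp_all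
    also have "\<dots> \<le> limsup (\<lambda>q. ereal (u (Suc (k (s q)))))"
      using k(3) by (intro Limsup_mono always_eventually) (auto intro: less_imp_le)
    finally show ?thesis .
  qed
  ultimately have "ereal \<omega> \<le> ereal (\<omega> - \<epsilon>)" by order
  with assms(6) show False by simp
qed

text \<open>A late value well below \<omega> drags the next \<open>m\<close> values below \<omega>
  as well, each with its own positive margin. Together they fill a whole window, whose maximum would
  then lie below \<omega>.\<close>

lemma nonmonotone_descent_liminf:
  fixes Z :: "nat \<Rightarrow> 'c::{heine_borel,real_normed_vector}" and u W :: "nat \<Rightarrow> real"
  assumes "bounded (range Z)" "0 < a" "W \<longlonglongrightarrow> \<omega>"
    and W: "\<And>k. \<omega> \<le> W k" "\<And>k. \<exists>j\<in>{k - m..k}. W k = u j"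
    and "\<And>k. u (Suc k) \<le> W k - a * (norm (Z (Suc k) - Z k))\<^sup>2"
    and "\<And>r p. (\<lambda>q. Z (r q)) \<longlonglongrightarrow> p \<Longrightarrow> (\<lambda>q. Z (Suc (r q))) \<longlonglongrightarrow> p \<Longrightarrow>
      limsup (\<lambda>q. ereal (u (Suc (r q)))) \<le> liminf (\<lambda>q. ereal (u (r q)))"
  shows "ereal \<omega> \<le> liminf (\<lambda>k. ereal (u k))"
proof -
  have step: "\<exists>e'>0. \<exists>K. \<forall>k\<ge>K. u k \<le> \<omega> - e \<longrightarrow> u (Suc k) \<le> \<omega> - e'" if "0 < e" for e
  proof (rule nonmonotone_descent_step[OF assms(1-3,6) _ that])
    fix r p assume "(\<lambda>q. Z (r q)) \<longlonglongrightarrow> p" "(\<lambda>q. Z (Suc (r q))) \<longlonglongrightarrow> p"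
    then show "limsup (\<lambda>q. ereal (u (Suc (r q)))) \<le> liminf (\<lambda>q. ereal (u (r q)))"
      by (rule assms(7))
  qed
  \<comment> \<open>The margin may shrink with every application of \<open>step\<close>, but the
    number of applications is fixed, so the minimum of the margins stays positive.\<close>
  have iter: "\<exists>\<epsilon>'>0. \<exists>K. \<forall>k\<ge>K. u k \<le> \<omega> - \<epsilon> \<longrightarrow> (\<forall>j\<le>n. u (k + j) \<le> \<omega> - \<epsilon>')"
    if "0 < \<epsilon>" for \<epsilon> n
  proof (induction n)
    case 0
    then show ?case using that by auto
  next
    case (Suc n)
    then obtain e K where e: "e > 0"
      "\<And>k j. k \<ge> K \<Longrightarrow> u k \<le> \<omega> - \<epsilon> \<Longrightarrow> j \<le> n \<Longrightarrow> u (k + j) \<le> \<omega> - e" by blast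
    obtain e' K' where e': "e' > 0" "\<And>k. k \<ge> K' \<Longrightarrow> u k \<le> \<omega> - e \<Longrightarrow> u (Suc k) \<le> \<omega> - e'"
      using step[OF e(1)] by blast
    have "u (k + j) \<le> \<omega> - min e e'" if "k \<ge> max K K'" "u k \<le> \<omega> - \<epsilon>" "j \<le> Suc n" for k j
    proof (cases "j \<le> n")
      case True
      then show ?thesis using e(2)[of k j] that by auto
    next
      case False
      with that have "j = Suc n" by simp
      moreover have "u (Suc (k + n)) \<le> \<omega> - e'"
        using e(2)[of k n] e'(2)[of "k + n"] that by auto
      ultimately show ?thesis by simp
    qed
    then have "\<exists>K. \<forall>k\<ge>K. u k \<le> \<omega> - \<epsilon> \<longrightarrow> (\<forall>j\<le>Suc n. u (k + j) \<le> \<omega> - min e e')"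
      by blast
    moreover have "0 < min e e'" using e(1) e'(1) by simp
    ultimately show ?case by blast
  qed
  show ?thesis
    unfolding le_Liminf_iff
  proof (intro allI impI)
    fix c :: ereal assume "c < ereal \<omega>"
    then obtain r where r: "c < ereal r" "r < \<omega>"
      using ereal_dense2[of c "ereal \<omega>"] by auto
    then obtain e K where e: "e > 0"
      "\<And>k j. k \<ge> K \<Longrightarrow> u k \<le> \<omega> - (\<omega> - r) \<Longrightarrow> j \<le> m \<Longrightarrow> u (k + j) \<le> \<omega> - e"
      using iter[of "\<omega> - r" m] by auto
    have "c < ereal (u k)" if "k \<ge> K" for k
    proof (rule ccontr)
      assume "\<not> c < ereal (u k)"
      then have "ereal (u k) \<le> c" by simp
      also note r(1)
      finally have "u k \<le> \<omega> - (\<omega> - r)" by simp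
      \<comment> \<open>The window ending at \<open>k + m\<close> is exactly
        \<open>{k..k + m}\<close>; the subtraction is not truncated there.\<close>
      moreover obtain j where "j \<in> {k..k + m}" "W (k + m) = u j"
        using W(2)[of "k + m"] by auto
      ultimately have "W (k + m) \<le> \<omega> - e"
        using e(2)[OF that, of "j - k"] by auto
      with W(1)[of "k + m"] e(1) show False by linarith
    qed
    then show "\<forall>\<^sub>F k in sequentially. c < ereal (u k)"
      unfolding eventually_sequentially by blast
  qed
qed

text \<open>The set of maximizing indices is finite and nonempty, so its largest element is a
  maximizer too. This turns the values at the argmax indices into the window maxima.\<close>

lemma window_argmax_value:
  "V (window_argmax m V k) = window_max m V k"
proof -
  let ?J = "{j. is_arg_max V (\<lambda>j. j \<in> {k - m..k}) j}"
  have "window_max m V k \<in> V ` {k - m..k}"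
    unfolding window_max_def by (intro Max_in) auto
  then obtain i where i: "i \<in> {k - m..k}" "V i = window_max m V k" by auto
  have le: "V j \<le> window_max m V k" if "j \<in> {k - m..k}" for j
    unfolding window_max_def using that by (intro Max_ge) auto
  have "i \<in> ?J" using i le by (auto simp: is_arg_max_linorder)
  moreover have "finite ?J"
    by (rule finite_subset[of _ "{k - m..k}"]) (auto simp: is_arg_max_linorder)
  ultimately have "window_argmax m V k \<in> ?J"
    unfolding window_argmax_def by (intro Max_in) auto
  then have "V i \<le> V (window_argmax m V k)" "window_argmax m V k \<in> {k - m..k}"
    using i(1) by (auto simp: is_arg_max_linorder)
  with i(2) le show ?thesis by (metis order_antisym)
qed

subsection \<open>The Lipschitz modulus from difference quotients\<close>

text \<open>If \<open>a = b\<close>, moving towards \<open>c\<close> and \<open>d\<close> separates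
  the points by \<open>t *\<^sub>R (c - d)\<close>; if \<open>a\<close> and \<open>b\<close> already
  differ, they stay where they are.\<close>

lemma perturb_distinct:
  fixes a b c d :: "'a::real_vector"
  assumes "a \<in> B" "b \<in> B" "c \<in> B" "d \<in> B" "c \<noteq> d"
  obtains a' b' where "a' \<in> B" "b' \<in> B"
    "\<And>t::real. 0 < t \<Longrightarrow> (1 - t) *\<^sub>R a + t *\<^sub>R a' \<noteq> (1 - t) *\<^sub>R b + t *\<^sub>R b'"
proof (cases "a = b")
  case True
  have "(1 - t) *\<^sub>R a + t *\<^sub>R c \<noteq> (1 - t) *\<^sub>R b + t *\<^sub>R d" if "0 < t" for t :: real
    using True that assms(5) by simp
  with assms(3,4) show ?thesis by (rule that)
next
  case False
  then show ?thesis using that[of a b] assms by (simp flip: scaleR_left_distrib)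
qed

lemma gradx_quotients_le_Sup:
  fixes H :: "'a::euclidean_space \<times> 'b::euclidean_space \<Rightarrow> real"
  assumes "bdd_above (gradx_quotients H B1 B2)"
    and "x \<in> B1" "x' \<in> B1" "x \<noteq> x'" "y \<in> B2" "y' \<in> B2" "y \<noteq> y'"
  shows "norm (grad_x H x y - grad_x H x' y')
    \<le> Sup (gradx_quotients H B1 B2) * norm ((x, y) - (x', y'))"
proof -
  have "norm (grad_x H x y - grad_x H x' y') / norm ((x, y) - (x', y')) \<in> gradx_quotients H B1 B2"
    using assms(2-) unfolding gradx_quotients_def by blast
  from cSup_upper[OF this assms(1)] show ?thesis
    using assms(4) by (simp add: pos_divide_le_eq zero_prod_def)
qed

text \<open>The quotients only range over pairs that differ in both components; the remaining pairs are
  limits of such pairs.\<close>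

lemma grad_x_lipschitz_Sup_quotients:
  fixes H :: "'a::euclidean_space \<times> 'b::euclidean_space \<Rightarrow> real"
  assumes H: "C1_smooth H" and bdd: "bdd_above (gradx_quotients H B1 B2)"
    and B1: "convex B1" "c1 \<in> B1" "d1 \<in> B1" "c1 \<noteq> d1"
    and B2: "convex B2" "c2 \<in> B2" "d2 \<in> B2" "c2 \<noteq> d2"
    and x: "x \<in> B1" "x' \<in> B1" and y: "y \<in> B2" "y' \<in> B2"
  shows "norm (grad_x H x y - grad_x H x' y')
    \<le> Sup (gradx_quotients H B1 B2) * norm ((x, y) - (x', y'))"
proof -
  obtain a a' where a: "a \<in> B1" "a' \<in> B1"
    "\<And>t::real. 0 < t \<Longrightarrow> (1 - t) *\<^sub>R x + t *\<^sub>R a \<noteq> (1 - t) *\<^sub>R x' + t *\<^sub>R a'"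
    using perturb_distinct[OF x B1(2-4)] by blast
  obtain b b' where b: "b \<in> B2" "b' \<in> B2"
    "\<And>t::real. 0 < t \<Longrightarrow> (1 - t) *\<^sub>R y + t *\<^sub>R b \<noteq> (1 - t) *\<^sub>R y' + t *\<^sub>R b'"
    using perturb_distinct[OF y B2(2-4)] by blast
  \<comment> \<open>For \<open>t\<close> in (0,1) convexity keeps both curves in the product of
    \<open>B1\<close> and \<open>B2\<close>, where they differ in both components; as
    \<open>t\<close> decreases to 0 they tend to the given pairs.\<close>
  define p where "p t = ((1 - t) *\<^sub>R x + t *\<^sub>R a, (1 - t) *\<^sub>R y + t *\<^sub>R b)" for t :: real
  define p' where "p' t = ((1 - t) *\<^sub>R x' + t *\<^sub>R a', (1 - t) *\<^sub>R y' + t *\<^sub>R b')" for t :: real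
  have lim: "(p \<longlongrightarrow> (x, y)) (at_right 0)" "(p' \<longlongrightarrow> (x', y')) (at_right 0)"
    unfolding p_def p'_def by (auto intro!: tendsto_eq_intros)
  have grad: "((\<lambda>t. gradient H (q t)) \<longlongrightarrow> gradient H w) (at_right 0)"
    if "(q \<longlongrightarrow> w) (at_right 0)" for q w
  proof (rule isCont_tendsto_compose[OF _ that])
    show "isCont (gradient H) w"
      using C1_smooth_continuous_gradient[OF H, of UNIV]
      by (cases w) (simp add: continuous_on_eq_continuous_at)
  qed
  have "norm (fst (gradient H (x, y)) - fst (gradient H (x', y')))
      \<le> Sup (gradx_quotients H B1 B2) * norm ((x, y) - (x', y'))"
  proof (rule tendsto_le)
    show "((\<lambda>t. Sup (gradx_quotients H B1 B2) * norm (p t - p' t)) \<longlongrightarrow>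
        Sup (gradx_quotients H B1 B2) * norm ((x, y) - (x', y'))) (at_right 0)"
      by (intro tendsto_intros lim)
    show "((\<lambda>t. norm (fst (gradient H (p t)) - fst (gradient H (p' t)))) \<longlongrightarrow>
        norm (fst (gradient H (x, y)) - fst (gradient H (x', y')))) (at_right 0)"
      by (intro tendsto_intros grad lim)
    have "\<forall>\<^sub>F t in at_right (0::real). t \<in> {0<..<1}"
      by (rule eventually_at_right_real) simp
    then show "\<forall>\<^sub>F t in at_right 0. norm (fst (gradient H (p t)) - fst (gradient H (p' t)))
        \<le> Sup (gradx_quotients H B1 B2) * norm (p t - p' t)"
    proof eventually_elim
      case (elim t)
      then have t: "0 \<le> 1 - t" "0 \<le> t" "(1 - t) + t = 1" "0 < t" by auto
      show ?case
        unfolding p_def p'_def grad_x_eq_fst_gradient[OF H, symmetric]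
        using t a b x y B1(1) B2(1)
        by (intro gradx_quotients_le_Sup[OF bdd] convexD) auto
    qed
  qed simp
  then show ?thesis by (simp add: grad_x_eq_fst_gradient[OF H])
qed

text \<open>For one pair differing in both components, a norm is at most \<open>Sup\<close> times a
  positive distance.\<close>

lemma Sup_gradx_quotients_nonneg:
  fixes H :: "'a::euclidean_space \<times> 'b::euclidean_space \<Rightarrow> real"
  assumes "bdd_above (gradx_quotients H B1 B2)"
    and "c1 \<in> B1" "d1 \<in> B1" "c1 \<noteq> d1" "c2 \<in> B2" "d2 \<in> B2" "c2 \<noteq> d2"
  shows "0 \<le> Sup (gradx_quotients H B1 B2)"
proof -
  have "0 \<le> Sup (gradx_quotients H B1 B2) * norm ((c1, c2) - (d1, d2))"
    using gradx_quotients_le_Sup[OF assms] norm_ge_zero order_trans by blast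
  then show ?thesis using assms(4) by (auto simp: zero_le_mult_iff zero_prod_def)
qed

subsection \<open>Extrapolation in balls\<close>

lemma origin_ball_solid:
  fixes p q :: "'a::real_normed_vector"
  assumes "B = ball 0 r \<or> B = cball 0 r" "q \<in> B" "norm p \<le> norm q"
  shows "p \<in> B"
  using assms by auto

text \<open>Supplies the distinct points that the difference quotients require; half the radius
  along a basis vector lies in the open and the closed ball alike.\<close>

lemma origin_ball_two_points:
  fixes B :: "'a::euclidean_space set"
  assumes "B = ball 0 r \<or> B = cball 0 r" "0 < r"
  obtains c where "0 \<in> B" "c \<in> B" "0 \<noteq> c"
proof -
  obtain e :: 'a where "e \<in> Basis" using nonempty_Basis by blast
  with assms have "0 \<in> B" "(r / 2) *\<^sub>R e \<in> B" "0 \<noteq> (r / 2) *\<^sub>R e"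
    using nonzero_Basis by auto
  then show thesis by (rule that)
qed

text \<open>The difference \<open>a - b\<close> has norm at most \<open>2 * r\<close>, which
  explains the factor \<open>1 + 2 * \<beta>max\<close> in the choice of the balls.\<close>

lemma norm_extrapolation_le:
  assumes "0 \<le> \<beta>" "\<beta> \<le> \<beta>max" "norm a \<le> r" "norm b \<le> r"
  shows "norm (a + \<beta> *\<^sub>R (a - b)) \<le> (1 + 2 * \<beta>max) * r"
proof -
  have "norm (\<beta> *\<^sub>R (a - b)) \<le> \<beta>max * (r + r)"
    using assms norm_triangle_le_diff[of a b "r + r"] by (auto intro!: mult_mono)
  then show ?thesis using norm_triangle_ineq[of a "\<beta> *\<^sub>R (a - b)"] assms(3)
    by (simp add: algebra_simps)
qed

text \<open>The extrapolated point is no longer than \<open>1 + 2 * \<beta>max\<close> times the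
  longer of \<open>a\<close> and \<open>b\<close>, and that multiple lies in the ball by
  assumption.\<close>

lemma extrapolation_in_origin_ball:
  fixes a b :: "'a::real_normed_vector"
  assumes "B = ball 0 r \<or> B = cball 0 r" "0 \<le> \<beta>" "\<beta> \<le> \<beta>max"
    and "(1 + 2 * \<beta>max) *\<^sub>R a \<in> B" "(1 + 2 * \<beta>max) *\<^sub>R b \<in> B"
  shows "a + \<beta> *\<^sub>R (a - b) \<in> B"
proof -
  have pos: "0 \<le> 1 + 2 * \<beta>max" using assms(2,3) by linarith
  obtain q where q: "q \<in> {a, b}" "norm a \<le> norm q" "norm b \<le> norm q"
    by (metis insertCI linear order_refl)
  have "norm (a + \<beta> *\<^sub>R (a - b)) \<le> norm ((1 + 2 * \<beta>max) *\<^sub>R q)"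
    using norm_extrapolation_le[OF assms(2,3) q(2,3)] pos by simp
  moreover have "(1 + 2 * \<beta>max) *\<^sub>R q \<in> B" using q(1) assms(4,5) by blast
  ultimately show ?thesis using origin_ball_solid[OF assms(1)] by blast
qed

subsection \<open>The merit function\<close>

text \<open>Gathers all real-valued terms into one continuous \<open>R\<close>, so that only
  \<open>f\<close> and \<open>g\<close> call for extended-real arguments; on the diagonal the
  coupling squares vanish.\<close>

lemma Upsilon_smooth_part:
  fixes H :: "'a::euclidean_space \<times> 'b::euclidean_space \<Rightarrow> real"
  assumes "C1_smooth H"
  obtains R where "\<And>w. isCont R w" "\<And>a b. R (a, b, a, b) = H (a, b)"
    "\<And>f g w. Upsilon \<delta> f g H w = f (fst w) + g (fst (snd w)) + ereal (R w)"
proof -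
  define R where "R = (\<lambda>(x, y, u, v). H (x, y) + \<delta> / 2 * (norm (x - u))\<^sup>2 + \<delta> / 2 * (norm (y - v))\<^sup>2)"
  have contH: "continuous_on UNIV H"
    using assms unfolding C1_smooth_def
    by (simp add: differentiable_imp_continuous_on differentiable_on_def)
  have "continuous_on UNIV R"
    unfolding R_def case_prod_beta
    by (intro continuous_intros continuous_on_compose2[OF contH]) auto
  then have "isCont R w" for w
    using continuous_on_eq_continuous_at[OF open_UNIV, of R] by blast
  moreover have "Upsilon \<delta> f g H w = f (fst w) + g (fst (snd w)) + ereal (R w)" for f g w
    unfolding Upsilon_def R_def by (cases w) (simp add: add.assoc)
  ultimately show thesis by (intro that[of R]) (simp_all add: R_def)
qed

lemma Upsilon_liminf:
  fixes f :: "'a::euclidean_space \<Rightarrow> ereal" and g :: "'b::euclidean_space \<Rightarrow> ereal"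
  assumes f: "lower_semicont f" "bounded_below f" and g: "lower_semicont g" "bounded_below g"
    and H: "C1_smooth H" and lim: "zs \<longlonglongrightarrow> p"
  shows "Upsilon \<delta> f g H p \<le> liminf (\<lambda>n. Upsilon \<delta> f g H (zs n))"
proof -
  obtain a b u v where p: "p = (a, b, u, v)" by (metis prod.collapse)
  define F where "F n = f (fst (zs n))" for n
  define G where "G n = g (fst (snd (zs n)))" for n
  obtain R where "isCont R p"
    and U: "\<And>w. Upsilon \<delta> f g H w = f (fst w) + g (fst (snd w)) + ereal (R w)"
    using Upsilon_smooth_part[OF H] by metis
  then have R: "(\<lambda>n. ereal (R (zs n))) \<longlonglongrightarrow> ereal (R p)"
    using lim by (simp add: isCont_tendsto_compose)
  have lF: "f a \<le> liminf F"
    unfolding F_def using tendsto_fst[OF lim] p by (intro lower_semicont_liminf[OF f(1)]) simp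
  have lG: "g b \<le> liminf G"
    unfolding G_def using tendsto_fst[OF tendsto_snd[OF lim]] p
    by (intro lower_semicont_liminf[OF g(1)]) simp
  \<comment> \<open>Lower bounds on \<open>f\<close> and \<open>g\<close> exclude liminf
    -\<infinity>, so superadditivity of liminf applies in the extended reals.\<close>
  obtain cf where "\<And>w. ereal cf \<le> f w" using f(2) unfolding bounded_below_def by blast
  then have "ereal cf \<le> liminf F"
    unfolding F_def by (intro Liminf_bounded always_eventually) simp
  then have nF: "liminf F \<noteq> - \<infinity>" by auto
  obtain cg where "\<And>w. ereal cg \<le> g w" using g(2) unfolding bounded_below_def by blast
  then have "ereal cg \<le> liminf G"
    unfolding G_def by (intro Liminf_bounded always_eventually) simp
  then have nG: "liminf G \<noteq> - \<infinity>" by auto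
  have lR: "liminf (\<lambda>n. ereal (R (zs n))) = ereal (R p)"
    using R by (rule lim_imp_Liminf[rotated]) simp
  have FG: "liminf F + liminf G \<le> liminf (\<lambda>n. F n + G n)"
    using nF nG by (intro ereal_liminf_add_mono) auto
  have "Upsilon \<delta> f g H p = f a + g b + ereal (R p)" by (simp add: U p)
  also have "\<dots> \<le> liminf (\<lambda>n. F n + G n) + liminf (\<lambda>n. ereal (R (zs n)))"
    unfolding lR using lF lG FG by (intro add_right_mono) (metis add_mono order_trans)
  also have "\<dots> \<le> liminf (\<lambda>n. F n + G n + ereal (R (zs n)))"
    using lR by (intro ereal_liminf_add_mono) auto
  finally show ?thesis by (simp add: U F_def G_def)
qed

text \<open>Adding the two proximal minorants, the expansion of \<open>H\<close> and the convexity
  estimates for the coupling squares gives a minorant of \<open>Upsilon\<close> that is exact at the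
  base point up to first order. The last two components of the vector come from the squares
  alone.\<close>

lemma Upsilon_subgradient:
  fixes f :: "'a::euclidean_space \<Rightarrow> ereal" and g :: "'b::euclidean_space \<Rightarrow> ereal"
  assumes "proper f" "proper g" "C1_smooth H" "0 < \<tau>1" "0 < \<tau>2" "0 \<le> \<delta>"
    and px: "xn \<in> prox \<tau>1 f cx" and py: "yn \<in> prox \<tau>2 g cy"
  shows "((cx - xn) /\<^sub>R \<tau>1 + grad_x H xn yn + \<delta> *\<^sub>R (xn - u),
          (cy - yn) /\<^sub>R \<tau>2 + grad_y H xn yn + \<delta> *\<^sub>R (yn - v),
          - (\<delta> *\<^sub>R (xn - u)), - (\<delta> *\<^sub>R (yn - v)))
         \<in> frechet_subdiff (Upsilon \<delta> f g H) (xn, yn, u, v)" (is "?w \<in> _")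
proof -
  obtain fr where fr: "f xn = ereal fr"
    using prox_finite[OF assms(1) px] by (cases "f xn") auto
  obtain gr where gr: "g yn = ereal gr"
    using prox_finite[OF assms(2) py] by (cases "g yn") auto
  define G where "G = gradient H (xn, yn)"
  \<comment> \<open>\<open>K\<close> is the joint curvature of the two proximal minorants.\<close>
  define K where "K = 1 / (2 * \<tau>1) + 1 / (2 * \<tau>2)"
  have K: "K > 0" unfolding K_def using assms(4,5) by (simp add: add_pos_pos)
  define c where "c = fr + gr + H (xn, yn) + \<delta> / 2 * (norm (xn - u))\<^sup>2 + \<delta> / 2 * (norm (yn - v))\<^sup>2"
  \<comment> \<open>Gradient inequality of a convex quadratic; applied to \<open>x' - u'\<close> and
    \<open>y' - v'\<close>, it consumes none of the error allowance \<open>e\<close>.\<close>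
  have quad: "\<delta> / 2 * (norm a)\<^sup>2 + \<delta> * inner a (b - a) \<le> \<delta> / 2 * (norm b)\<^sup>2"
    for a b :: "'c::real_inner"
  proof -
    have "(norm b)\<^sup>2 = (norm a)\<^sup>2 + 2 * inner a (b - a) + (norm (b - a))\<^sup>2"
      by (simp add: power2_norm_eq_inner algebra_simps inner_commute)
    then have "\<delta> / 2 * (norm b)\<^sup>2 = \<delta> / 2 * (norm a)\<^sup>2 + \<delta> * inner a (b - a) + \<delta> / 2 * (norm (b - a))\<^sup>2"
      by (simp add: field_simps)
    then show ?thesis using assms(6) by simp
  qed
  show ?thesis
  proof (rule frechet_subdiffI)
    show "Upsilon \<delta> f g H (xn, yn, u, v) = ereal c"
      by (simp add: Upsilon_def fr gr c_def)
    fix e :: real assume e: "e > 0"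
    then obtain d where d: "d > 0"
      "\<And>q. norm (q - (xn, yn)) < d \<Longrightarrow>
        norm (H q - H (xn, yn) - inner (q - (xn, yn)) G) \<le> e / 2 * norm (q - (xn, yn))"
      using C1_smooth_has_derivative[OF assms(3), of "(xn, yn)"]
      unfolding has_derivative_at_alt G_def by (metis half_gt_zero)
    \<comment> \<open>Half of \<open>e\<close> pays for the remainder of \<open>H\<close>,
      controlled within radius \<open>d\<close>; the other half pays for the curvature
      \<open>K * N * N\<close>, since radius \<open>e / (2 * K)\<close> forces
      \<open>K * N \<le> e / 2\<close>.\<close>
    have bound: "ereal (c + inner ?w (z' - (xn, yn, u, v)) - e * norm (z' - (xn, yn, u, v)))
        \<le> Upsilon \<delta> f g H z'"
      if close: "norm (z' - (xn, yn, u, v)) < min d (e / (2 * K))" for z'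
    proof -
      obtain x' y' u' v' where z': "z' = (x', y', u', v')" by (metis prod.collapse)
      define N where "N = norm (z' - (xn, yn, u, v))"
      have n3: "norm ((x', y') - (xn, yn)) \<le> N"
        unfolding N_def z' norm_prod_def by (auto simp: algebra_simps)
      have n: "norm (x' - xn) \<le> N" "norm (y' - yn) \<le> N" "norm ((x', y') - (xn, yn)) \<le> N"
        using n3 norm_fst_le[of "x' - xn" "y' - yn"] norm_snd_le[of "y' - yn" "x' - xn"] by auto
      have N: "0 \<le> N" "N < d" "K * N \<le> e / 2"
        using close K unfolding N_def by (auto simp: field_simps)
      have "(norm (x' - xn))\<^sup>2 / (2 * \<tau>1) + (norm (y' - yn))\<^sup>2 / (2 * \<tau>2)
          \<le> N\<^sup>2 / (2 * \<tau>1) + N\<^sup>2 / (2 * \<tau>2)"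
        using n assms(4,5) by (intro add_mono divide_right_mono power_mono) auto
      also have "\<dots> = K * N * N" unfolding K_def by (simp add: power2_eq_square field_simps)
      also have "\<dots> \<le> e / 2 * N" using N by (intro mult_right_mono) auto
      finally have sq: "(norm (x' - xn))\<^sup>2 / (2 * \<tau>1) + (norm (y' - yn))\<^sup>2 / (2 * \<tau>2) \<le> e / 2 * N" .
      have "\<bar>H (x', y') - H (xn, yn) - inner ((x', y') - (xn, yn)) G\<bar> \<le> e / 2 * norm ((x', y') - (xn, yn))"
        using d(2)[of "(x', y')"] n(3) N(2) by simp
      also have "\<dots> \<le> e / 2 * N" using n(3) e by (intro mult_left_mono) auto
      finally have Hlow: "H (xn, yn) + inner ((x', y') - (xn, yn)) G - e / 2 * N \<le> H (x', y')" by linarith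
      have qx: "\<delta> / 2 * (norm (xn - u))\<^sup>2 + \<delta> * inner (xn - u) ((x' - u') - (xn - u)) \<le> \<delta> / 2 * (norm (x' - u'))\<^sup>2"
        and qy: "\<delta> / 2 * (norm (yn - v))\<^sup>2 + \<delta> * inner (yn - v) ((y' - v') - (yn - v)) \<le> \<delta> / 2 * (norm (y' - v'))\<^sup>2"
        by (rule quad)+
      define A where "A = inner ((cx - xn) /\<^sub>R \<tau>1) (x' - xn)"
      define B where "B = inner ((cy - yn) /\<^sub>R \<tau>2) (y' - yn)"
      have "inner ?w (z' - (xn, yn, u, v)) = A + B + inner ((x', y') - (xn, yn)) G
          + \<delta> * inner (xn - u) ((x' - u') - (xn - u)) + \<delta> * inner (yn - v) ((y' - v') - (yn - v))"
        unfolding z' A_def B_def G_def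
        by (simp add: grad_x_eq_fst_gradient[OF assms(3)] grad_y_eq_snd_gradient[OF assms(3)]
            inner_prod_def inner_add_left inner_add_right inner_diff_right inner_diff_left inner_commute
            right_diff_distrib distrib_left)
      with sq Hlow qx qy have "c + inner ?w (z' - (xn, yn, u, v)) - e * N
          \<le> (fr + A - (norm (x' - xn))\<^sup>2 / (2 * \<tau>1)) + (gr + B - (norm (y' - yn))\<^sup>2 / (2 * \<tau>2))
            + H (x', y') + \<delta> / 2 * (norm (x' - u'))\<^sup>2 + \<delta> / 2 * (norm (y' - v'))\<^sup>2"
        unfolding c_def by linarith
      then have "ereal (c + inner ?w (z' - (xn, yn, u, v)) - e * N)
          \<le> ereal (fr + A - (norm (x' - xn))\<^sup>2 / (2 * \<tau>1)) + ereal (gr + B - (norm (y' - yn))\<^sup>2 / (2 * \<tau>2))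
            + ereal (H (x', y')) + ereal (\<delta> / 2 * (norm (x' - u'))\<^sup>2) + ereal (\<delta> / 2 * (norm (y' - v'))\<^sup>2)"
        by simp
      also have "\<dots> \<le> f x' + g y' + ereal (H (x', y')) + ereal (\<delta> / 2 * (norm (x' - u'))\<^sup>2)
            + ereal (\<delta> / 2 * (norm (y' - v'))\<^sup>2)"
        unfolding A_def B_def
        using prox_lower_bound[OF assms(1) px assms(4) fr, of x'] prox_lower_bound[OF assms(2) py assms(5) gr, of y']
        by (intro add_mono order_refl)
      finally show ?thesis unfolding N_def by (simp add: z' Upsilon_def)
    qed
    have "min d (e / (2 * K)) > 0" using d(1) e K by simp
    with bound show "\<forall>\<^sub>F z' in at (xn, yn, u, v).
        ereal (c + inner ?w (z' - (xn, yn, u, v)) - e * norm (z' - (xn, yn, u, v))) \<le> Upsilon \<delta> f g H z'"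
      unfolding eventually_at dist_norm by blast
  qed
qed

subsection \<open>The iterates of PALMenls\<close>

text \<open>Only the accepted trial \<open>l\<close> is kept. Backtracking leaves \<beta> in its
  initial range because powers of \<eta> are at most 1, and the \<open>max\<close> keeps both step
  sizes at least \<open>\<tau>lo\<close>.\<close>

lemma palmenls_accepted_trial:
  assumes "palmenls f g H \<delta> \<alpha> \<tau>lo \<tau>up \<beta>max \<eta> \<eta>1 \<eta>2 m x y" "0 < \<eta>" "\<eta> < 1"
  obtains \<beta> \<tau>1 \<tau>2 where "0 \<le> \<beta>" "\<beta> \<le> \<beta>max" "\<tau>lo \<le> \<tau>1" "\<tau>lo \<le> \<tau>2"
    "palm_trial f g H x y k \<beta> \<tau>1 \<tau>2 (x (Suc k)) (y (Suc k))"
    "ls_accept f g H \<delta> \<alpha> m x y k (x (Suc k)) (y (Suc k))"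
proof -
  have "palmenls_step f g H \<delta> \<alpha> \<tau>lo \<tau>up \<beta>max \<eta> \<eta>1 \<eta>2 m x y k"
    using assms(1) unfolding palmenls_def by blast
  then obtain \<beta>0 \<tau>10 \<tau>20 l X Y where s: "\<beta>0 \<in> {0..\<beta>max}"
    "\<forall>i\<le>l. palm_trial f g H x y k (\<beta>0 * \<eta> ^ i)
       (max (\<tau>10 * \<eta>1 ^ i) \<tau>lo) (max (\<tau>20 * \<eta>2 ^ i) \<tau>lo) (X i) (Y i)"
    "ls_accept f g H \<delta> \<alpha> m x y k (X l) (Y l)" "x (Suc k) = X l" "y (Suc k) = Y l"
    unfolding palmenls_step_def by blast
  have "\<eta> ^ l \<le> 1" using assms(2,3) by (simp add: power_le_one)
  then have "\<beta>0 * \<eta> ^ l \<le> \<beta>0" "0 \<le> \<beta>0 * \<eta> ^ l"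
    using s(1) assms(2) by (auto intro: mult_left_le)
  with s show thesis
    by (intro that[of "\<beta>0 * \<eta> ^ l" "max (\<tau>10 * \<eta>1 ^ l) \<tau>lo" "max (\<tau>20 * \<eta>2 ^ l) \<tau>lo"]) auto
qed

text \<open>Division by \<tau> leaves \<open>w /\<^sub>R \<tau> - G\<close>, which is bounded
  uniformly over all steps at least \<open>\<tau>lo\<close>. This is the slope bound required by
  \<open>prox_values_upper\<close>.\<close>

lemma norm_scaled_center_le:
  assumes "0 < \<tau>lo" "\<tau>lo \<le> \<tau>" "norm w \<le> r" "norm G \<le> b"
  shows "norm ((w - \<tau> *\<^sub>R G) /\<^sub>R \<tau>) \<le> r / \<tau>lo + b"
proof -
  have "(w - \<tau> *\<^sub>R G) /\<^sub>R \<tau> = w /\<^sub>R \<tau> - G"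
    using assms(1,2) by (simp add: scaleR_diff_right)
  moreover have "norm (w /\<^sub>R \<tau>) \<le> inverse \<tau>lo * r"
    using assms mult_mono[of "inverse \<tau>" "inverse \<tau>lo" "norm w" r] le_imp_inverse_le[of \<tau>lo \<tau>] by simp
  ultimately show ?thesis
    using norm_triangle_ineq4[of "w /\<^sub>R \<tau>" G] assms(4) by (simp add: field_simps)
qed

text \<open>The centre of the proximal step need not converge along the subsequence; only
  its quotient by the step size is needed, and that stays bounded.\<close>

lemma palm_Upsilon_limsup:
  fixes f :: "'a::euclidean_space \<Rightarrow> ereal" and g :: "'b::euclidean_space \<Rightarrow> ereal"
  assumes f: "proper f" and g: "proper g" and H: "C1_smooth H" and \<tau>lo: "0 < \<tau>lo"
    and bx: "\<And>k. norm (x k) \<le> rx" and bdy: "\<And>k. norm (y k) \<le> ry"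
    and trial: "\<And>k. \<exists>\<beta> \<tau>1 \<tau>2. 0 \<le> \<beta> \<and> \<beta> \<le> \<beta>max \<and> \<tau>lo \<le> \<tau>1 \<and> \<tau>lo \<le> \<tau>2 \<and>
      palm_trial f g H x y k \<beta> \<tau>1 \<tau>2 (x (Suc k)) (y (Suc k))"
    and lim: "(\<lambda>q. zseq x y (Suc (s q))) \<longlonglongrightarrow> (a, b, a, b)"
  shows "limsup (\<lambda>q. Upsilon \<delta> f g H (zseq x y (Suc (s q)))) \<le> Upsilon \<delta> f g H (a, b, a, b)"
proof -
  obtain \<beta> \<tau>1 \<tau>2 where tr: "\<And>k. 0 \<le> \<beta> k" "\<And>k. \<beta> k \<le> \<beta>max" "\<And>k. \<tau>lo \<le> \<tau>1 k" "\<And>k. \<tau>lo \<le> \<tau>2 k"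
    "\<And>k. palm_trial f g H x y k (\<beta> k) (\<tau>1 k) (\<tau>2 k) (x (Suc k)) (y (Suc k))"
    using trial by metis
  define xt where "xt k = x k + \<beta> k *\<^sub>R (x k - x (k - 1))" for k
  define yt where "yt k = y k + \<beta> k *\<^sub>R (y k - y (k - 1))" for k
  have prox: "x (Suc k) \<in> prox (\<tau>1 k) f (xt k - \<tau>1 k *\<^sub>R grad_x H (xt k) (y k))"
    "y (Suc k) \<in> prox (\<tau>2 k) g (yt k - \<tau>2 k *\<^sub>R grad_y H (x (Suc k)) (yt k))" for k
    using tr(5)[of k] unfolding palm_trial_def xt_def yt_def Let_def by auto
  have bxt: "norm (xt k) \<le> (1 + 2 * \<beta>max) * rx" and byt: "norm (yt k) \<le> (1 + 2 * \<beta>max) * ry" for k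
    unfolding xt_def yt_def using tr(1,2) bx bdy by (auto intro: norm_extrapolation_le)
  \<comment> \<open>The two partial gradients are evaluated at \<open>(xt k, y k)\<close> and
    \<open>(x (Suc k), yt k)\<close>; each box is enlarged only in its extrapolated
    component.\<close>
  have "bounded (cball (0::'a) ((1 + 2 * \<beta>max) * rx) \<times> cball (0::'b) ry)"
    by (intro bounded_Times bounded_cball)
  then obtain bG where bG: "\<And>p. p \<in> cball (0::'a) ((1 + 2 * \<beta>max) * rx) \<times> cball (0::'b) ry \<Longrightarrow>
      norm (gradient H p) \<le> bG"
    using C1_smooth_bounded_gradient[OF H] by metis
  have "bounded (cball (0::'a) rx \<times> cball (0::'b) ((1 + 2 * \<beta>max) * ry))"
    by (intro bounded_Times bounded_cball)
  then obtain bG' where bG': "\<And>p. p \<in> cball (0::'a) rx \<times> cball (0::'b) ((1 + 2 * \<beta>max) * ry) \<Longrightarrow>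
      norm (gradient H p) \<le> bG'"
    using C1_smooth_bounded_gradient[OF H] by metis
  have gx: "norm (grad_x H (xt k) (y k)) \<le> bG" for k
    using norm_fst_le[of "fst (gradient H (xt k, y k))" "snd (gradient H (xt k, y k))"]
      bG[of "(xt k, y k)"] bxt[of k] bdy[of k]
    by (simp add: grad_x_eq_fst_gradient[OF H])
  have gy: "norm (grad_y H (x (Suc k)) (yt k)) \<le> bG'" for k
    using norm_snd_le[of "snd (gradient H (x (Suc k), yt k))" "fst (gradient H (x (Suc k), yt k))"]
      bG'[of "(x (Suc k), yt k)"] byt[of k] bx[of "Suc k"]
    by (simp add: grad_y_eq_snd_gradient[OF H])
  have "\<exists>e. e \<longlonglongrightarrow> 0 \<and> (\<forall>q. f (x (Suc (s q))) \<le> f a + ereal (e q))"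
  proof (rule prox_values_upper[OF f \<tau>lo _ prox(1)])
    show "(\<lambda>q. x (Suc (s q))) \<longlonglongrightarrow> a"
      using tendsto_fst[OF lim] by (simp add: zseq_def)
    show "\<tau>lo \<le> \<tau>1 (s q)" for q by (rule tr)
    show "norm ((xt (s q) - \<tau>1 (s q) *\<^sub>R grad_x H (xt (s q)) (y (s q))) /\<^sub>R \<tau>1 (s q))
      \<le> (1 + 2 * \<beta>max) * rx / \<tau>lo + bG" for q
      by (rule norm_scaled_center_le[OF \<tau>lo tr(3) bxt gx])
  qed
  then obtain e1 where e1: "e1 \<longlonglongrightarrow> 0" "\<And>q. f (x (Suc (s q))) \<le> f a + ereal (e1 q)"
    by blast
  have "\<exists>e. e \<longlonglongrightarrow> 0 \<and> (\<forall>q. g (y (Suc (s q))) \<le> g b + ereal (e q))"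
  proof (rule prox_values_upper[OF g \<tau>lo _ prox(2)])
    show "(\<lambda>q. y (Suc (s q))) \<longlonglongrightarrow> b"
      using tendsto_fst[OF tendsto_snd[OF lim]] by (simp add: zseq_def)
    show "\<tau>lo \<le> \<tau>2 (s q)" for q by (rule tr)
    show "norm ((yt (s q) - \<tau>2 (s q) *\<^sub>R grad_y H (x (Suc (s q))) (yt (s q))) /\<^sub>R \<tau>2 (s q))
      \<le> (1 + 2 * \<beta>max) * ry / \<tau>lo + bG'" for q
      by (rule norm_scaled_center_le[OF \<tau>lo tr(4) byt gy])
  qed
  then obtain e2 where e2: "e2 \<longlonglongrightarrow> 0" "\<And>q. g (y (Suc (s q))) \<le> g b + ereal (e2 q)"
    by blast
  obtain R where R: "\<And>w. isCont R w" "R (a, b, a, b) = H (a, b)"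
    "\<And>w. Upsilon \<delta> f g H w = f (fst w) + g (fst (snd w)) + ereal (R w)"
    using Upsilon_smooth_part[OF H] by metis
  define e3 where "e3 q = R (zseq x y (Suc (s q)))" for q
  have e3: "e3 \<longlonglongrightarrow> H (a, b)"
    unfolding e3_def using isCont_tendsto_compose[OF R(1) lim] R(2) by simp
  have le: "Upsilon \<delta> f g H (zseq x y (Suc (s q))) \<le> (f a + g b) + ereal (e1 q + e2 q + e3 q)" for q
  proof -
    have "Upsilon \<delta> f g H (zseq x y (Suc (s q))) = f (x (Suc (s q))) + g (y (Suc (s q))) + ereal (e3 q)"
      by (simp add: R(3) e3_def) (simp add: zseq_def)
    also have "\<dots> \<le> (f a + ereal (e1 q)) + (g b + ereal (e2 q)) + ereal (e3 q)"
      by (intro add_mono e1(2) e2(2) order_refl)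
    also have "\<dots> = (f a + g b) + ereal (e1 q + e2 q + e3 q)"
      by (simp only: plus_ereal.simps(1)[symmetric] ac_simps)
    finally show ?thesis .
  qed
  have nab: "f a \<noteq> - \<infinity>" "g b \<noteq> - \<infinity>" using f g unfolding proper_def by auto
  have Uab: "Upsilon \<delta> f g H (a, b, a, b) = f a + g b + ereal (H (a, b))"
    by (simp add: Upsilon_def)
  have "(\<lambda>q. e1 q + e2 q + e3 q) \<longlonglongrightarrow> 0 + 0 + H (a, b)"
    by (intro tendsto_intros e1 e2 e3)
  then have "(\<lambda>q. ereal (e1 q + e2 q + e3 q)) \<longlonglongrightarrow> ereal (H (a, b))" by simp
  \<comment> \<open>\<open>f a + g b\<close> may be \<infinity>; the sum still converges because the
    second summand has a real limit.\<close>
  then have "(\<lambda>q. (f a + g b) + ereal (e1 q + e2 q + e3 q)) \<longlonglongrightarrow> (f a + g b) + ereal (H (a, b))"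
    by (intro tendsto_add_ereal_general tendsto_const) simp_all
  then have "limsup (\<lambda>q. (f a + g b) + ereal (e1 q + e2 q + e3 q)) = Upsilon \<delta> f g H (a, b, a, b)"
    unfolding Uab by (intro lim_imp_Limsup trivial_limit_sequentially)
  moreover have "limsup (\<lambda>q. Upsilon \<delta> f g H (zseq x y (Suc (s q))))
      \<le> limsup (\<lambda>q. (f a + g b) + ereal (e1 q + e2 q + e3 q))"
    by (intro Limsup_mono always_eventually allI le)
  ultimately show ?thesis by simp
qed

text \<open>After inserting the centres, each proximal block is a scaled displacement plus a
  difference of gradients. All displacements involved are at most
  \<open>2 * max 1 \<beta>max * N\<close>; the two blocks contribute one
  \<open>inverse \<tau>lo\<close> each, and the coupling squares contribute
  \<open>2 * \<delta>\<close>.\<close>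

lemma palm_subgradient_bound:
  fixes f :: "'a::euclidean_space \<Rightarrow> ereal" and g :: "'b::euclidean_space \<Rightarrow> ereal"
  assumes f: "proper f" and g: "proper g" and H: "C1_smooth H" and \<delta>: "0 \<le> \<delta>"
    and par: "0 < \<tau>lo" "0 \<le> \<beta>" "\<beta> \<le> \<beta>max" "\<tau>lo \<le> \<tau>1" "\<tau>lo \<le> \<tau>2"
    and trial: "palm_trial f g H x y k \<beta> \<tau>1 \<tau>2 (x (Suc k)) (y (Suc k))"
    and M: "0 \<le> M" "norm (grad_x H (x (Suc k)) (y (Suc k))
        - grad_x H (x k + \<beta> *\<^sub>R (x k - x (k - 1))) (y k))
      \<le> M * norm ((x (Suc k), y (Suc k)) - (x k + \<beta> *\<^sub>R (x k - x (k - 1)), y k))"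
    and L2: "0 \<le> L2" "norm (grad_y H (x (Suc k)) (y (Suc k))
        - grad_y H (x (Suc k)) (y k + \<beta> *\<^sub>R (y k - y (k - 1))))
      \<le> L2 * norm (y (Suc k) - (y k + \<beta> *\<^sub>R (y k - y (k - 1))))"
  shows "\<exists>w \<in> limiting_subdiff (Upsilon \<delta> f g H) (zseq x y (Suc k)).
    norm w \<le> (2 * \<delta> + 2 * max 1 \<beta>max * (M + 2 * inverse \<tau>lo + L2))
      * norm (zseq x y (Suc k) - zseq x y k)"
proof -
  define xt where "xt = x k + \<beta> *\<^sub>R (x k - x (k - 1))"
  define yt where "yt = y k + \<beta> *\<^sub>R (y k - y (k - 1))"
  define N where "N = norm (zseq x y (Suc k) - zseq x y k)"
  define b where "b = max 1 \<beta>max"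
  define dx where "dx = x (Suc k) - x k"
  define dy where "dy = y (Suc k) - y k"
  define gx where "gx = grad_x H xt (y k)"
  define gy where "gy = grad_y H (x (Suc k)) yt"
  have \<tau>: "0 < \<tau>1" "0 < \<tau>2" "inverse \<tau>1 \<le> inverse \<tau>lo" "inverse \<tau>2 \<le> inverse \<tau>lo"
    using par by (auto intro: le_imp_inverse_le)
  \<comment> \<open>The maximum handles at once the plain step, with coefficient 1, and the
    extrapolation step, with coefficient \<beta>.\<close>
  have b: "1 \<le> b" "\<beta> \<le> b" "0 \<le> b" unfolding b_def using par(3) by auto
  have diff: "zseq x y (Suc k) - zseq x y k = (dx, dy, x k - x (k - 1), y k - y (k - 1))"
    by (simp add: zseq_def dx_def dy_def)
  have Nxy: "norm (dx, dy) \<le> N"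
    unfolding N_def diff norm_prod_def by simp
  then have Ndx: "norm dx \<le> N" and Ndy: "norm dy \<le> N"
    using norm_fst_le[of dx dy] norm_snd_le[of dy dx] by auto
  have Nuv: "norm (x k - x (k - 1), y k - y (k - 1)) \<le> N"
    unfolding N_def diff norm_prod_def by simp
  then have Nu: "norm (x k - x (k - 1)) \<le> N" and Nv: "norm (y k - y (k - 1)) \<le> N"
    using norm_fst_le[of "x k - x (k - 1)" "y k - y (k - 1)"]
      norm_snd_le[of "y k - y (k - 1)" "x k - x (k - 1)"] by auto
  have N: "0 \<le> N" unfolding N_def by simp
  have bN: "N \<le> b * N" "\<beta> * N \<le> b * N"
    using b N mult_right_mono[of 1 b N] by (auto intro: mult_right_mono)
  have su: "norm (\<beta> *\<^sub>R (x k - x (k - 1))) \<le> b * N" and sv: "norm (\<beta> *\<^sub>R (y k - y (k - 1))) \<le> b * N"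
    using Nu Nv par(2) b by (auto intro!: mult_mono)
  have ex_eq: "x (Suc k) - xt = dx - \<beta> *\<^sub>R (x k - x (k - 1))" by (simp add: xt_def dx_def)
  have ex: "norm (x (Suc k) - xt) \<le> 2 * (b * N)"
    unfolding ex_eq using norm_triangle_ineq4[of dx "\<beta> *\<^sub>R (x k - x (k - 1))"] Ndx su bN by linarith
  have ey_eq: "y (Suc k) - yt = dy - \<beta> *\<^sub>R (y k - y (k - 1))" by (simp add: yt_def dy_def)
  have ey: "norm (y (Suc k) - yt) \<le> 2 * (b * N)"
    unfolding ey_eq using norm_triangle_ineq4[of dy "\<beta> *\<^sub>R (y k - y (k - 1))"] Ndy sv bN by linarith
  \<comment> \<open>Only the first component is extrapolated in the x-step. Treating
    \<open>(dx, dy)\<close> as one vector of norm at most \<open>N\<close> keeps the constant at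
    2.\<close>
  have exy_eq: "(x (Suc k), y (Suc k)) - (xt, y k) = (dx, dy) - (\<beta> *\<^sub>R (x k - x (k - 1)), 0)"
    by (simp add: xt_def dx_def dy_def)
  have "norm (\<beta> *\<^sub>R (x k - x (k - 1)), 0::'b) = norm (\<beta> *\<^sub>R (x k - x (k - 1)))"
    by (simp add: norm_prod_def)
  then have exy: "norm ((x (Suc k), y (Suc k)) - (xt, y k)) \<le> 2 * (b * N)"
    unfolding exy_eq using norm_triangle_ineq4[of "(dx, dy)" "(\<beta> *\<^sub>R (x k - x (k - 1)), 0::'b)"] Nxy su bN
    by linarith
  have px: "x (Suc k) \<in> prox \<tau>1 f (xt - \<tau>1 *\<^sub>R gx)" and py: "y (Suc k) \<in> prox \<tau>2 g (yt - \<tau>2 *\<^sub>R gy)"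
    using trial unfolding palm_trial_def xt_def yt_def gx_def gy_def Let_def by auto
  define \<xi> where "\<xi> = (xt - \<tau>1 *\<^sub>R gx - x (Suc k)) /\<^sub>R \<tau>1 + grad_x H (x (Suc k)) (y (Suc k))"
  define \<zeta> where "\<zeta> = (yt - \<tau>2 *\<^sub>R gy - y (Suc k)) /\<^sub>R \<tau>2 + grad_y H (x (Suc k)) (y (Suc k))"
  define w where "w = (\<xi> + \<delta> *\<^sub>R dx, \<zeta> + \<delta> *\<^sub>R dy, - (\<delta> *\<^sub>R dx), - (\<delta> *\<^sub>R dy))"
  have "w \<in> frechet_subdiff (Upsilon \<delta> f g H) (zseq x y (Suc k))"
    using Upsilon_subgradient[OF f g H \<tau>(1,2) \<delta> px py, of "x k" "y k"]
    unfolding w_def \<xi>_def \<zeta>_def dx_def dy_def zseq_def by simp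
  then have sub: "w \<in> limiting_subdiff (Upsilon \<delta> f g H) (zseq x y (Suc k))"
    using frechet_subdiff_subset_limiting_subdiff by blast
  \<comment> \<open>The gradient step inside the centre, divided by \<open>\<tau>1\<close>, becomes
    \<open>- gx\<close>, which pairs with the gradient at the new iterate.\<close>
  have "\<xi> = (xt - x (Suc k)) /\<^sub>R \<tau>1 + (grad_x H (x (Suc k)) (y (Suc k)) - gx)"
    using \<tau>(1) unfolding \<xi>_def by (simp add: algebra_simps)
  then have "norm \<xi> \<le> inverse \<tau>1 * norm (x (Suc k) - xt) + norm (grad_x H (x (Suc k)) (y (Suc k)) - gx)"
    using norm_triangle_ineq[of "(xt - x (Suc k)) /\<^sub>R \<tau>1" "grad_x H (x (Suc k)) (y (Suc k)) - gx"] \<tau>(1)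
    by (simp add: norm_minus_commute[of "xt" "x (Suc k)"])
  also have "\<dots> \<le> inverse \<tau>lo * (2 * (b * N)) + M * (2 * (b * N))"
  proof (rule add_mono)
    show "inverse \<tau>1 * norm (x (Suc k) - xt) \<le> inverse \<tau>lo * (2 * (b * N))"
      using ex \<tau> par(1) by (intro mult_mono) auto
    show "norm (grad_x H (x (Suc k)) (y (Suc k)) - gx) \<le> M * (2 * (b * N))"
      using M(2) mult_left_mono[OF exy M(1)] unfolding gx_def xt_def by linarith
  qed
  finally have n\<xi>: "norm \<xi> \<le> inverse \<tau>lo * (2 * (b * N)) + M * (2 * (b * N))" .
  have "\<zeta> = (yt - y (Suc k)) /\<^sub>R \<tau>2 + (grad_y H (x (Suc k)) (y (Suc k)) - gy)"
    using \<tau>(2) unfolding \<zeta>_def by (simp add: algebra_simps)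
  then have "norm \<zeta> \<le> inverse \<tau>2 * norm (y (Suc k) - yt) + norm (grad_y H (x (Suc k)) (y (Suc k)) - gy)"
    using norm_triangle_ineq[of "(yt - y (Suc k)) /\<^sub>R \<tau>2" "grad_y H (x (Suc k)) (y (Suc k)) - gy"] \<tau>(2)
    by (simp add: norm_minus_commute[of "yt" "y (Suc k)"])
  also have "\<dots> \<le> inverse \<tau>lo * (2 * (b * N)) + L2 * (2 * (b * N))"
  proof (rule add_mono)
    show "inverse \<tau>2 * norm (y (Suc k) - yt) \<le> inverse \<tau>lo * (2 * (b * N))"
      using ey \<tau> par(1) by (intro mult_mono) auto
    show "norm (grad_y H (x (Suc k)) (y (Suc k)) - gy) \<le> L2 * (2 * (b * N))"
      using L2(2) mult_left_mono[OF ey L2(1)] unfolding gy_def yt_def by linarith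
  qed
  finally have n\<zeta>: "norm \<zeta> \<le> inverse \<tau>lo * (2 * (b * N)) + L2 * (2 * (b * N))" .
  \<comment> \<open>The coupling part is a difference of two shifted copies of
    \<open>(dx, dy)\<close>, so its norm is at most \<open>2 * N\<close>.\<close>
  have w: "w = (\<xi>, \<zeta>, 0, 0) + \<delta> *\<^sub>R ((dx, dy, 0, 0) - (0, 0, dx, dy))"
    unfolding w_def by simp
  have "norm ((dx, dy, 0::'a, 0::'b) - (0, 0, dx, dy)) \<le> norm (dx, dy, 0::'a, 0::'b) + norm (0::'a, 0::'b, dx, dy)"
    by (rule norm_triangle_ineq4)
  also have "\<dots> = 2 * norm (dx, dy)" by (simp add: norm_prod_def)
  finally have nd: "norm ((dx, dy, 0::'a, 0::'b) - (0, 0, dx, dy)) \<le> 2 * N" using Nxy by linarith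
  have "norm (\<xi>, \<zeta>, 0::'a, 0::'b) = norm (\<xi>, \<zeta>)" by (simp add: norm_prod_def)
  also have "\<dots> \<le> norm \<xi> + norm \<zeta>" by (rule norm_Pair_le)
  finally have "norm w \<le> norm \<xi> + norm \<zeta> + \<delta> * (2 * N)"
    unfolding w using norm_triangle_ineq[of "(\<xi>, \<zeta>, 0::'a, 0::'b)" "\<delta> *\<^sub>R ((dx, dy, 0, 0) - (0, 0, dx, dy))"]
      mult_left_mono[OF nd \<delta>] \<delta> by (smt (verit) norm_scaleR)
  also have "\<dots> \<le> (2 * \<delta> + 2 * b * (M + 2 * inverse \<tau>lo + L2)) * N"
    using n\<xi> n\<zeta> by (simp add: algebra_simps)
  finally show ?thesis using sub unfolding N_def b_def by blast
qed

theorem lemma5p2: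
  fixes f :: "'a::euclidean_space \<Rightarrow> ereal" and g :: "'b::euclidean_space \<Rightarrow> ereal"
    and H :: "'a \<times> 'b \<Rightarrow> real" and L1 :: "'b \<Rightarrow> real" and L2 :: "'a \<Rightarrow> real"
    and L M L2bar \<delta> \<alpha> \<tau>lo \<tau>up \<beta>max \<eta> \<eta>1 \<eta>2 r1 r2 :: real and m :: nat
    and x :: "nat \<Rightarrow> 'a" and y :: "nat \<Rightarrow> 'b" and B1 :: "'a set" and B2 :: "'b set"
  defines "z \<equiv> zseq x y"
  defines "U \<equiv> Upsilon \<delta> f g H"
  defines "\<l> \<equiv> window_argmax m (\<lambda>j. U (z j))"
  defines "\<L>0 \<equiv> {p. Psi f g H p \<le> Psi f g H (x 0, y 0)}"
  assumes f: "proper f" "lower_semicont f" "bounded_below f"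
    and g: "proper g" "lower_semicont g" "bounded_below g"
    and H: "C1_smooth H"
    and L1: "\<And>v. (L1 v)-lipschitz_on UNIV (\<lambda>u. grad_x H u v)"
    and L2: "\<And>u. (L2 u)-lipschitz_on UNIV (\<lambda>v. grad_y H u v)"
    and Psi: "coercive (Psi f g H)" "bounded_below (Psi f g H)"
    and L: "bdd_above ((\<lambda>(u, v). max (L1 v) (L2 u)) ` \<L>0)"
           "L = (SUP (u, v)\<in>\<L>0. max (L1 v) (L2 u))"
    and \<delta>: "\<delta> \<in> {0<..<1}" and \<alpha>: "\<alpha> \<in> {0<..\<delta> / 2}"
    and \<tau>: "0 < \<tau>lo" "\<tau>lo < 1 / (L + \<delta> + 2 * \<alpha>)" "1 / (L + \<delta> + 2 * \<alpha>) < \<tau>up"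
    and \<beta>max: "0 \<le> \<beta>max"
    and \<eta>: "\<eta> \<in> {0<..<1}" "\<eta>1 \<in> {0<..<1}" "\<eta>2 \<in> {0<..<1}"
    and alg: "palmenls f g H \<delta> \<alpha> \<tau>lo \<tau>up \<beta>max \<eta> \<eta>1 \<eta>2 m x y"
    and B1: "0 < r1" "B1 = ball 0 r1 \<or> B1 = cball 0 r1" "\<And>k. (1 + 2 * \<beta>max) *\<^sub>R x k \<in> B1"
    and B2: "0 < r2" "B2 = ball 0 r2 \<or> B2 = cball 0 r2" "\<And>k. (1 + 2 * \<beta>max) *\<^sub>R y k \<in> B2"
    and M: "bdd_above (gradx_quotients H B1 B2)" "M = Sup (gradx_quotients H B1 B2)"
    and L2bar: "bdd_above (L2 ` B1)" "L2bar = (SUP u\<in>B1. L2 u)"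
  shows "(convergent (\<lambda>k. U (z (\<l> k))) \<and>
           liminf (\<lambda>k. U (z k)) \<ge> lim (\<lambda>k. U (z (\<l> k)))) \<and>
         (\<forall>r :: nat \<Rightarrow> nat. \<forall>xh yh. strict_mono r \<longrightarrow> (\<lambda>q. z (r q)) \<longlonglongrightarrow> (xh, yh, xh, yh) \<longrightarrow>
           limsup (\<lambda>q. U (z (r q))) \<le> U (xh, yh, xh, yh)) \<and>
         (\<forall>k. \<exists>w \<in> limiting_subdiff U (z (Suc k)).
           norm w \<le> (2 * \<delta> + 2 * max 1 \<beta>max * (M + 2 * inverse \<tau>lo + L2bar))
                      * norm (z (Suc k) - z k))"
proof -

  \<comment> \<open>Accepted trials, bounded iterates and the limsup estimate\<close>
  have \<eta>01: "0 < \<eta>" "\<eta> < 1" using \<eta>(1) by auto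
  have ex_trial: "\<exists>\<beta> \<tau>1 \<tau>2. 0 \<le> \<beta> \<and> \<beta> \<le> \<beta>max \<and> \<tau>lo \<le> \<tau>1 \<and> \<tau>lo \<le> \<tau>2 \<and>
      palm_trial f g H x y k \<beta> \<tau>1 \<tau>2 (x (Suc k)) (y (Suc k))" for k
    using palmenls_accepted_trial[OF alg \<eta>01] by metis
  have accept: "ls_accept f g H \<delta> \<alpha> m x y k (x (Suc k)) (y (Suc k))" for k
    using palmenls_accepted_trial[OF alg \<eta>01] by metis
  have z_Suc: "z (Suc k) = (x (Suc k), y (Suc k), x k, y k)" for k
    by (simp add: z_def zseq_def)
  \<comment> \<open>The factor \<open>1 + 2 * \<beta>max\<close> is at least 1, so the iterates are
    no longer than their multiples in the balls.\<close>
  have memB: "x k \<in> B1" "y k \<in> B2" for k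
    using \<beta>max origin_ball_solid[OF B1(2) B1(3)[of k], of "x k"] origin_ball_solid[OF B2(2) B2(3)[of k], of "y k"]
    by (auto intro: mult_right_le_one_le mult_left_le simp: mult_le_cancel_right1)
  have bnd: "norm (x k) \<le> r1" "norm (y k) \<le> r2" for k
    using memB[of k] B1(2) B2(2) by auto

  \<comment> \<open>Stated for arbitrary index sequences \<open>s\<close>, so that it serves (i) and
    (ii). The \<open>Suc\<close> makes every listed point the output of a proximal step.\<close>
  have limsup_diag: "limsup (\<lambda>q. U (z (Suc (s q)))) \<le> U (a, b, a, b)"
    if "(\<lambda>q. z (Suc (s q))) \<longlonglongrightarrow> (a, b, a, b)" for s a b
    using palm_Upsilon_limsup[OF f(1) g(1) H \<tau>(1) bnd ex_trial] that
    unfolding U_def z_def by blast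

  \<comment> \<open>Finite merit values and convergence of the window maxima\<close>
  have finite_U: "\<bar>U (z k)\<bar> \<noteq> \<infinity>" for k
  proof -
    have "\<bar>f (x k)\<bar> \<noteq> \<infinity> \<and> \<bar>g (y k)\<bar> \<noteq> \<infinity>"
    proof (cases k)
      case 0
      have "Psi f g H (x 0, y 0) < \<infinity>" using alg unfolding palmenls_def by blast
      moreover have "f (x 0) \<noteq> - \<infinity>" "g (y 0) \<noteq> - \<infinity>"
        using f(1) g(1) unfolding proper_def by auto
      ultimately show ?thesis using 0 unfolding Psi_def
        by (cases "f (x 0)"; cases "g (y 0)") auto
    next
      case (Suc j)
      with ex_trial[of j] show ?thesis
        unfolding palm_trial_def Let_def by (metis prox_finite f(1) g(1))
    qed
    then show ?thesis
      unfolding U_def z_def zseq_def Upsilon_def by (cases "f (x k)"; cases "g (y k)") auto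
  qed
  define u where "u k = real_of_ereal (U (z k))" for k
  have U_u: "U (z k) = ereal (u k)" for k
    unfolding u_def using finite_U by (simp add: ereal_real')
  define W where "W k = Max (u ` {k - m..k})" for k
  have W_window: "window_max m (\<lambda>j. ereal (u j)) k = ereal (W k)" for k
  proof -
    have "ereal (W k) = Max (ereal ` u ` {k - m..k})"
      unfolding W_def by (intro mono_Max_commute) (auto simp: mono_def)
    then show ?thesis by (simp add: window_max_def image_image)
  qed
  have W_in: "\<exists>j\<in>{k - m..k}. W k = u j" for k
  proof -
    have "W k \<in> u ` {k - m..k}" unfolding W_def by (intro Max_in) auto
    then show ?thesis by blast
  qed
  have descent: "u (Suc k) \<le> W k - \<alpha> / 2 * (norm (z (Suc k) - z k))\<^sup>2" for k
  proof -
    have "U (z (Suc k)) \<le> window_max m (\<lambda>j. U (z j)) k - ereal (\<alpha> / 2 * (norm (z (Suc k) - z k))\<^sup>2)"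
      using accept[of k] unfolding ls_accept_def Let_def U_def[symmetric] z_def[symmetric] z_Suc[symmetric] .
    then show ?thesis by (simp add: W_window U_u)
  qed
  have "W (Suc k) \<le> W k" for k
  proof -
    \<comment> \<open>The new maximum sits either at the new index, where descent applies, or at an
      index of the previous window.\<close>
    obtain j where j: "j \<in> {Suc k - m..Suc k}" "W (Suc k) = u j" using W_in by blast
    show ?thesis
    proof (cases "j = Suc k")
      case True
      have "0 \<le> \<alpha> / 2 * (norm (z (Suc k) - z k))\<^sup>2" using \<alpha> by simp
      with descent[of k] have "u (Suc k) \<le> W k" by linarith
      with True j(2) show ?thesis by simp
    next
      case False
      with j(1) have "u j \<le> W k" unfolding W_def by (intro Max_ge) auto
      with j(2) show ?thesis by simp
    qed
  qed
  then have dec: "decseq W" by (rule decseq_SucI)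
  obtain c where c: "\<And>p. ereal c \<le> Psi f g H p" using Psi(2) unfolding bounded_below_def by blast
  have "c \<le> u k" for k
  proof -
    have "U (z k) = Psi f g H (x k, y k) + ereal (\<delta> / 2 * (norm (x k - x (k - 1)))\<^sup>2
        + \<delta> / 2 * (norm (y k - y (k - 1)))\<^sup>2)"
      by (simp add: U_def z_def zseq_def Upsilon_def Psi_def add.assoc)
    also have "\<dots> \<ge> ereal c + ereal 0"
      using \<delta> by (intro add_mono c) simp
    finally show ?thesis by (simp add: U_u)
  qed
  then have "c \<le> W k" for k using W_in[of k] by auto
  then obtain \<omega> where \<omega>: "W \<longlonglongrightarrow> \<omega>" "\<And>k. \<omega> \<le> W k"
    using decseq_convergent[OF dec, of c] by blast
  have "(\<lambda>k. U (z (\<l> k))) = (\<lambda>k. ereal (W k))"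
    using window_argmax_value[of "\<lambda>j. U (z j)" m] by (simp add: \<l>_def U_u W_window fun_eq_iff)
  then have lim_window: "(\<lambda>k. U (z (\<l> k))) \<longlonglongrightarrow> ereal \<omega>" using \<omega>(1) by simp

  \<comment> \<open>The liminf bound (i)\<close>
  have "ereal \<omega> \<le> liminf (\<lambda>k. ereal (u k))"
  proof (rule nonmonotone_descent_liminf[OF _ _ \<omega> W_in descent])
    have "range z \<subseteq> cball 0 r1 \<times> cball 0 r2 \<times> cball 0 r1 \<times> cball 0 r2"
      using bnd by (auto simp: z_def zseq_def)
    then show "bounded (range z)"
      by (rule bounded_subset[rotated]) (intro bounded_Times bounded_cball)
    show "0 < \<alpha> / 2" using \<alpha> by simp
    fix r p assume r: "(\<lambda>q. z (r q)) \<longlonglongrightarrow> p" "(\<lambda>q. z (Suc (r q))) \<longlonglongrightarrow> p"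
    obtain a b a' b' where p: "p = (a, b, a', b')" by (metis prod.collapse)
    \<comment> \<open>The last two blocks of \<open>z (Suc (r q))\<close> repeat the first two
      blocks of \<open>z (r q)\<close>, so the common limit \<open>p\<close> lies on the
      diagonal.\<close>
    have ab: "(\<lambda>q. x (r q)) \<longlonglongrightarrow> a" "(\<lambda>q. y (r q)) \<longlonglongrightarrow> b"
      using tendsto_fst[OF r(1)] tendsto_fst[OF tendsto_snd[OF r(1)]] by (simp_all add: z_def zseq_def p)
    have ab': "(\<lambda>q. x (r q)) \<longlonglongrightarrow> a'" "(\<lambda>q. y (r q)) \<longlonglongrightarrow> b'"
      using tendsto_fst[OF tendsto_snd[OF tendsto_snd[OF r(2)]]]
        tendsto_snd[OF tendsto_snd[OF tendsto_snd[OF r(2)]]] by (simp_all add: z_Suc p)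
    have "p = (a, b, a, b)"
      using LIMSEQ_unique[OF ab(1) ab'(1)] LIMSEQ_unique[OF ab(2) ab'(2)] p by simp
    with limsup_diag[of r a b] r(2) have "limsup (\<lambda>q. U (z (Suc (r q)))) \<le> U p" by simp
    also have "\<dots> \<le> liminf (\<lambda>q. U (z (r q)))"
      unfolding U_def by (rule Upsilon_liminf[OF f(2,3) g(2,3) H r(1)])
    finally show "limsup (\<lambda>q. ereal (u (Suc (r q)))) \<le> liminf (\<lambda>q. ereal (u (r q)))"
      by (simp add: U_u)
  qed
  then have i: "convergent (\<lambda>k. U (z (\<l> k))) \<and> liminf (\<lambda>k. U (z k)) \<ge> lim (\<lambda>k. U (z (\<l> k)))"
    unfolding limI[OF lim_window] using convergentI[OF lim_window] by (simp add: U_u)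

  \<comment> \<open>The limsup bound (ii)\<close>
  have ii: "limsup (\<lambda>q. U (z (r q))) \<le> U (a, b, a, b)"
    if r: "strict_mono r" and lim: "(\<lambda>q. z (r q)) \<longlonglongrightarrow> (a, b, a, b)" for r :: "nat \<Rightarrow> nat" and a b
  proof -
    \<comment> \<open>A strictly increasing \<open>r\<close> can take the value 0 only at
      \<open>q = 0\<close>; from then on each \<open>z (r q)\<close> is a successor iterate and
      \<open>limsup_diag\<close> applies.\<close>
    have "\<forall>\<^sub>F q in sequentially. 1 \<le> q" by (rule eventually_ge_at_top)
    then have ev: "\<forall>\<^sub>F q in sequentially. Suc (r q - 1) = r q"
    proof eventually_elim
      case (elim q)
      with strict_mono_imp_increasing[OF r, of q] show ?case by simp
    qed
    have "(\<lambda>q. z (Suc (r q - 1))) \<longlonglongrightarrow> (a, b, a, b)"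
      using lim by (rule Lim_transform_eventually) (use ev in \<open>auto elim: eventually_mono\<close>)
    then have "limsup (\<lambda>q. U (z (Suc (r q - 1)))) \<le> U (a, b, a, b)" by (rule limsup_diag)
    moreover have "limsup (\<lambda>q. U (z (r q))) = limsup (\<lambda>q. U (z (Suc (r q - 1))))"
      using ev by (intro Limsup_eq) (auto elim: eventually_mono)
    ultimately show ?thesis by simp
  qed

  \<comment> \<open>The subgradient bound (iii)\<close>
  obtain c1 where c1: "0 \<in> B1" "c1 \<in> B1" "0 \<noteq> c1"
    by (rule origin_ball_two_points[OF B1(2,1)])
  obtain c2 where c2: "0 \<in> B2" "c2 \<in> B2" "0 \<noteq> c2"
    by (rule origin_ball_two_points[OF B2(2,1)])
  have convex: "convex B1" "convex B2"
    using B1(2) B2(2) convex_ball convex_cball by metis+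
  have M0: "0 \<le> M"
    unfolding M(2) by (rule Sup_gradx_quotients_nonneg[OF M(1) c1 c2])
  have L2_le: "L2 a \<le> L2bar" if "a \<in> B1" for a
    unfolding L2bar(2) using L2bar(1) that by (rule cSUP_upper2[OF _ _ order_refl])
  have L20: "0 \<le> L2bar"
    using L2_le[OF c1(1)] lipschitz_on_nonneg[OF L2, of 0] by linarith
  have iii: "\<exists>w \<in> limiting_subdiff U (z (Suc k)).
      norm w \<le> (2 * \<delta> + 2 * max 1 \<beta>max * (M + 2 * inverse \<tau>lo + L2bar)) * norm (z (Suc k) - z k)" for k
  proof -
    obtain \<beta> \<tau>1 \<tau>2 where par: "0 \<le> \<beta>" "\<beta> \<le> \<beta>max" "\<tau>lo \<le> \<tau>1" "\<tau>lo \<le> \<tau>2"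
      and trial: "palm_trial f g H x y k \<beta> \<tau>1 \<tau>2 (x (Suc k)) (y (Suc k))"
      using ex_trial by metis
    have xt: "x k + \<beta> *\<^sub>R (x k - x (k - 1)) \<in> B1"
      by (rule extrapolation_in_origin_ball[OF B1(2) par(1,2) B1(3) B1(3)])
    show ?thesis
      unfolding U_def z_def
    proof (rule palm_subgradient_bound[OF f(1) g(1) H _ \<tau>(1) par trial M0 _ L20])
      show "0 \<le> \<delta>" using \<delta> by simp
      show "norm (grad_x H (x (Suc k)) (y (Suc k)) - grad_x H (x k + \<beta> *\<^sub>R (x k - x (k - 1))) (y k))
        \<le> M * norm ((x (Suc k), y (Suc k)) - (x k + \<beta> *\<^sub>R (x k - x (k - 1)), y k))"
        unfolding M(2)
        by (rule grad_x_lipschitz_Sup_quotients[OF H M(1) convex(1) c1 convex(2) c2 memB(1) xt memB(2) memB(2)])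
      let ?yt = "y k + \<beta> *\<^sub>R (y k - y (k - 1))"
      \<comment> \<open>The Lipschitz constant belongs to the slice at \<open>x (Suc k)\<close>;
        this point lies in \<open>B1\<close>, so \<open>L2bar\<close> dominates it.\<close>
      have "norm (grad_y H (x (Suc k)) (y (Suc k)) - grad_y H (x (Suc k)) ?yt)
          \<le> L2 (x (Suc k)) * norm (y (Suc k) - ?yt)"
        using lipschitz_onD[OF L2, of "y (Suc k)" ?yt] by (simp add: dist_norm)
      also have "\<dots> \<le> L2bar * norm (y (Suc k) - ?yt)"
        by (intro mult_right_mono L2_le memB) simp
      finally show "norm (grad_y H (x (Suc k)) (y (Suc k)) - grad_y H (x (Suc k)) ?yt)
          \<le> L2bar * norm (y (Suc k) - ?yt)" .
    qed
  qed
  show ?thesis using i ii iii by blast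
qed

end
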